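(* Let $(\Omega,\mathcal{F},\mu)$ be a (finite or infinite) $\sigma$-finite non-atomic measure space, let $(I,\mathcal{B}_m,m)$ be the corresponding standard measure space, and let $\mathbf{E}(\Omega,\mathcal{F},\mu)$ be a symmetric space on $(\Omega,\mathcal{F},\mu)$. Put $$\mathbf{E}(I,\mathcal{B}_m,m):=\{g\in\mathbf{L}_0(I,\mathcal{B}_m,m):\ \xi_{g,m}=\xi_{f,\mu}\ \text{for some } f\in\mathbf{E}(\Omega,\mathcal{F},\mu)\}$$ and $$\|g\|_{\mathbf{E}(I,\mathcal{B}_m,m)}:=\|f\|_{\mathbf{E}(\Omega,\mathcal{F},\mu)}\quad\text{if } \xi_{g,m}=\xi_{f,\mu}\ \text{and}\ f\in\mathbf{E}(\Omega,\mathcal{F},\mu).$$ Then $(\mathbf{E}(I,\mathcal{B}_m,m),\|\cdot\|_{\mathbf{E}(I,\mathcal{B}_m,m)})$ is a standard symmetric space, and the symmetric spaces $\mathbf{E}(\Omega,\mathcal{F},\mu)$ and $\mathbf{E}(I,\mathcal{B}_m,m)$ are strictly equimeasurable.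
   Context: All measure spaces $(\Omega,\mathcal{F},\mu)$ are assumed $\mu$-complete, with finite or infinite $\sigma$-finite non-atomic measure $\mu$, $\mu(\Omega)>0$. $\mathbf{L}_0(\Omega,\mathcal{F},\mu)$ is the space of $\mu$-a.e. equivalence classes of measurable functions $f\colon\Omega\to\mathbb{R}$. The standard measure space corresponding to $(\Omega,\mathcal{F},\mu)$ is $(I,\mathcal{B}_m,m)$, where $I=[0,\infty)$ if $\mu(\Omega)=\infty$ and $I=[0,a]$ if $\mu(\Omega)=a<\infty$, $m$ is Lebesgue measure and $\mathcal{B}_m$ is the $m$-completion of the Borel $\sigma$-algebra of $I$. For $f\in\mathbf{L}_0(\Omega,\mathcal{F},\mu)$ the distribution function is $\eta_{f,\mu}(x)=\mu(\{|f|>x\})$, $x\ge 0$, and the decreasing rearrangement is $\xi_{f,\mu}(x)=\inf\{y\in[0,\infty):\eta_{f,\mu}(y)\le x\}$ (with $\inf\emptyset=+\infty$), considered as a function on $I$; when it is finite $m$-a.e. on $I$ it is regarded as an element of $\mathbf{L}_0(I,\mathcal{B}_m,m)$. A symmetric space on $(\Omega,\mathcal{F},\mu)$ is a non-zero Banach or quasi-Banach space $(\mathbf{E},\|\cdot\|_{\mathbf{E}})$ which is a linear subspace of $\mathbf{L}_0(\Omega,\mathcal{F},\mu)$ such that: (1) if $f\in\mathbf{L}_0$, $g\in\mathbf{E}$ and $|f|\le|g|$, then $f\in\mathbf{E}$ and $\|f\|_{\mathbf{E}}\le\|g\|_{\mathbf{E}}$; (2) if $f\in\mathbf{L}_0$,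 $g\in\mathbf{E}$ and $\eta_{f,\mu}=\eta_{g,\mu}$, then $f\in\mathbf{E}$ and $\|f\|_{\mathbf{E}}=\|g\|_{\mathbf{E}}$. It is called standard if its underlying measure space is a standard one $(I,\mathcal{B}_m,m)$. For a symmetric space $\mathbf{E}=\mathbf{E}(\Omega,\mathcal{F},\mu)$ let $\Xi(\mathbf{E})=\{\xi_{f,\mu}\in\mathbf{L}_0(I,\mathcal{B}_m,m): f\in\mathbf{E}\}$ and $\|\xi_{f,\mu}\|_{\Xi(\mathbf{E})}=\|f\|_{\mathbf{E}}$ for $f\in\mathbf{E}$. Symmetric spaces $\mathbf{E}_1,\mathbf{E}_2$ (on possibly different measure spaces) are equimeasurable if $\Xi(\mathbf{E}_1)=\Xi(\mathbf{E}_2)$, and strictly equimeasurable if in addition $\|\cdot\|_{\Xi(\mathbf{E}_1)}=\|\cdot\|_{\Xi(\mathbf{E}_2)}$. *)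

theory Defs
  imports "HOL-Analysis.Analysis"
begin

locale nonatomic_measure_space = complete_measure M + sigma_finite_measure M
  for M :: "'a measure" +
  assumes space_pos: "emeasure M (space M) > 0"
    and nonatomic: "\<And>A. A \<in> sets M \<Longrightarrow> emeasure M A > 0 \<Longrightarrow>
      \<exists>B\<in>sets M. B \<subseteq> A \<and> 0 < emeasure M B \<and> emeasure M B < emeasure M A"

text \<open>
  The space \<open>L0\<close> is the honest quotient: its elements are the classes \<open>ae_class M f\<close> of
  measurable \<open>f\<close>. Operations and relations on classes are expressed through representatives.
  Values of a representative outside \<open>space M\<close> are irrelevant, since \<open>AE\<close> and measurability
  only see \<open>space M\<close>.
\<close>

definition ae_class :: "'a measure \<Rightarrow> ('a \<Rightarrow> real) \<Rightarrow> ('a \<Rightarrow> real) set" where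
  "ae_class M f = {g \<in> borel_measurable M. AE x in M. g x = f x}"

definition L0 :: "'a measure \<Rightarrow> ('a \<Rightarrow> real) set set" where
  "L0 M = ae_class M ` borel_measurable M"

definition standard_interval :: "'a measure \<Rightarrow> real set" where
  "standard_interval M =
     (if emeasure M (space M) = \<infinity> then {0..} else {0..measure M (space M)})"

definition standard_space :: "'a measure \<Rightarrow> real measure" where
  "standard_space M = lebesgue_on (standard_interval M)"

definition distribution :: "'a measure \<Rightarrow> ('a \<Rightarrow> real) \<Rightarrow> real \<Rightarrow> ennreal" where
  "distribution M f x = emeasure M {\<omega> \<in> space M. \<bar>f \<omega>\<bar> > x}"

text \<open>In \<open>ennreal\<close> the infimum of the empty set is \<open>\<infinity>\<close>.\<close>

definition rearrangement :: "'a measure \<Rightarrow> ('a \<Rightarrow> real) \<Rightarrow> real \<Rightarrow> ennreal" where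
  "rearrangement M f x = (INF y\<in>{y. 0 \<le> y \<and> distribution M f y \<le> ennreal x}. ennreal y)"

text \<open>
  The norm is a quasi-norm with modulus \<open>C\<close>; the Banach case is the one where \<open>C = 1\<close> is possible.
\<close>

locale symmetric_space = nonatomic_measure_space M
  for M :: "'a measure" and E :: "('a \<Rightarrow> real) set set" and N :: "('a \<Rightarrow> real) set \<Rightarrow> real" +
  assumes subset_L0: "E \<subseteq> L0 M"
    and zero_mem: "ae_class M (\<lambda>x. 0) \<in> E"
    and add_mem: "\<And>f g. \<lbrakk>f \<in> borel_measurable M; g \<in> borel_measurable M;
          ae_class M f \<in> E; ae_class M g \<in> E\<rbrakk> \<Longrightarrow> ae_class M (\<lambda>x. f x + g x) \<in> E"
    and scale_mem: "\<And>f c. \<lbrakk>f \<in> borel_measurable M; ae_class M f \<in> E\<rbrakk>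
          \<Longrightarrow> ae_class M (\<lambda>x. c * f x) \<in> E"
    and nonzero: "E \<noteq> {ae_class M (\<lambda>x. 0)}"
    and norm_nonneg: "\<And>F. F \<in> E \<Longrightarrow> N F \<ge> 0"
    and norm_eq_0_iff: "\<And>F. F \<in> E \<Longrightarrow> N F = 0 \<longleftrightarrow> F = ae_class M (\<lambda>x. 0)"
    and norm_scale: "\<And>f c. \<lbrakk>f \<in> borel_measurable M; ae_class M f \<in> E\<rbrakk>
          \<Longrightarrow> N (ae_class M (\<lambda>x. c * f x)) = \<bar>c\<bar> * N (ae_class M f)"
    and quasi_triangle: "\<exists>C\<ge>1. \<forall>f\<in>borel_measurable M. \<forall>g\<in>borel_measurable M.
          ae_class M f \<in> E \<longrightarrow> ae_class M g \<in> E \<longrightarrow>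
          N (ae_class M (\<lambda>x. f x + g x)) \<le> C * (N (ae_class M f) + N (ae_class M g))"
    and complete_norm: "\<And>u :: nat \<Rightarrow> 'a \<Rightarrow> real.
          \<lbrakk>\<And>n. u n \<in> borel_measurable M; \<And>n. ae_class M (u n) \<in> E;
           \<And>e. e > 0 \<Longrightarrow> \<exists>K. \<forall>m\<ge>K. \<forall>n\<ge>K. N (ae_class M (\<lambda>x. u m x - u n x)) < e\<rbrakk>
          \<Longrightarrow> \<exists>f\<in>borel_measurable M. ae_class M f \<in> E \<and>
                (\<lambda>n. N (ae_class M (\<lambda>x. u n x - f x))) \<longlonglongrightarrow> 0"
    and ideal: "\<And>f g. \<lbrakk>f \<in> borel_measurable M; g \<in> borel_measurable M; ae_class M g \<in> E;
           AE x in M. \<bar>f x\<bar> \<le> \<bar>g x\<bar>\<rbrakk>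
          \<Longrightarrow> ae_class M f \<in> E \<and> N (ae_class M f) \<le> N (ae_class M g)"
    and symmetric: "\<And>f g. \<lbrakk>f \<in> borel_measurable M; g \<in> borel_measurable M; ae_class M g \<in> E;
           \<forall>x\<ge>0. distribution M f x = distribution M g x\<rbrakk>
          \<Longrightarrow> ae_class M f \<in> E \<and> N (ae_class M f) = N (ae_class M g)"

definition standard_symmetric_space ::
    "real measure \<Rightarrow> (real \<Rightarrow> real) set set \<Rightarrow> ((real \<Rightarrow> real) set \<Rightarrow> real) \<Rightarrow> bool" where
  "standard_symmetric_space M E N \<longleftrightarrow> symmetric_space M E N \<and>
     (M = lebesgue_on {0..} \<or> (\<exists>a>0. M = lebesgue_on {0..a}))"

definition rearrangement_class :: "'a measure \<Rightarrow> ('a \<Rightarrow> real) \<Rightarrow> (real \<Rightarrow> real) set" where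
  "rearrangement_class M f = ae_class (standard_space M) (\<lambda>x. enn2real (rearrangement M f x))"

text \<open>
  Only an almost everywhere finite rearrangement is an element of \<open>L0\<close>, so finiteness is required
  explicitly; \<open>enn2real\<close> would turn \<open>\<infinity>\<close> into \<open>0\<close>.
\<close>

definition Xi :: "'a measure \<Rightarrow> ('a \<Rightarrow> real) set set \<Rightarrow> (real \<Rightarrow> real) set set" where
  "Xi M E = {rearrangement_class M f | f. f \<in> borel_measurable M \<and> ae_class M f \<in> E \<and>
     (AE x in standard_space M. rearrangement M f x < \<infinity>)}"

definition Xi_norm :: "'a measure \<Rightarrow> ('a \<Rightarrow> real) set set \<Rightarrow> (('a \<Rightarrow> real) set \<Rightarrow> real)
    \<Rightarrow> (real \<Rightarrow> real) set \<Rightarrow> real" where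
  "Xi_norm M E N H = (THE r. \<exists>f\<in>borel_measurable M. ae_class M f \<in> E \<and>
     (AE x in standard_space M. rearrangement M f x < \<infinity>) \<and>
     H = rearrangement_class M f \<and> r = N (ae_class M f))"

definition equimeasurable ::
    "'a measure \<Rightarrow> ('a \<Rightarrow> real) set set \<Rightarrow> 'b measure \<Rightarrow> ('b \<Rightarrow> real) set set \<Rightarrow> bool" where
  "equimeasurable M1 E1 M2 E2 \<longleftrightarrow> Xi M1 E1 = Xi M2 E2"

definition strictly_equimeasurable ::
    "'a measure \<Rightarrow> ('a \<Rightarrow> real) set set \<Rightarrow> (('a \<Rightarrow> real) set \<Rightarrow> real) \<Rightarrow>
     'b measure \<Rightarrow> ('b \<Rightarrow> real) set set \<Rightarrow> (('b \<Rightarrow> real) set \<Rightarrow> real) \<Rightarrow> bool" where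
  "strictly_equimeasurable M1 E1 N1 M2 E2 N2 \<longleftrightarrow> equimeasurable M1 E1 M2 E2 \<and>
     (\<forall>H\<in>Xi M1 E1. Xi_norm M1 E1 N1 H = Xi_norm M2 E2 N2 H)"

definition same_rearrangement :: "'a measure \<Rightarrow> (real \<Rightarrow> real) \<Rightarrow> ('a \<Rightarrow> real) \<Rightarrow> bool" where
  "same_rearrangement M g f \<longleftrightarrow>
     (\<forall>x\<in>standard_interval M. rearrangement (standard_space M) g x = rearrangement M f x)"

definition standard_E :: "'a measure \<Rightarrow> ('a \<Rightarrow> real) set set \<Rightarrow> (real \<Rightarrow> real) set set" where
  "standard_E M E = {ae_class (standard_space M) g | g. g \<in> borel_measurable (standard_space M) \<and>
     (\<exists>f\<in>borel_measurable M. ae_class M f \<in> E \<and> same_rearrangement M g f)}"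

definition standard_norm :: "'a measure \<Rightarrow> ('a \<Rightarrow> real) set set \<Rightarrow> (('a \<Rightarrow> real) set \<Rightarrow> real)
    \<Rightarrow> (real \<Rightarrow> real) set \<Rightarrow> real" where
  "standard_norm M E N G = (THE r. \<exists>g\<in>borel_measurable (standard_space M).
     \<exists>f\<in>borel_measurable M. G = ae_class (standard_space M) g \<and> ae_class M f \<in> E \<and>
       same_rearrangement M g f \<and> r = N (ae_class M f))"

end

theory Submission
  imports Defs
begin

text \<open>
  A non-atomic \<open>\<sigma>\<close>-finite space carries a measure-preserving map \<open>U\<close> into its standard interval:
  by Sierpinski's theorem a set of finite measure contains a dyadic chain of subsets of
  proportional measure, the index at which a point enters the chain is uniformly distributed, and
  countably many such functions are laid end to end. The map \<open>g \<mapsto> g \<circ> U\<close> is linear and preserves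
  order, distribution functions and hence rearrangements, so \<open>g\<close> lies in the standard space iff
  \<open>g \<circ> U\<close> lies in \<open>E\<close>, with the same norm. Every axiom is pulled back along this map. Only
  completeness needs more: the limit in \<open>E\<close> must again be of the form \<open>h \<circ> U\<close>. Convergence in norm
  implies convergence in measure, so some subsequence converges almost everywhere, and \<open>h\<close> is its
  pointwise limit on the interval. Finally, the rearrangement of \<open>f \<in> E\<close> is itself a function on the interval
  with the distribution of \<open>f\<close>, which gives strict equimeasurability.
\<close>

section \<open>Sierpinski's theorem and measure-preserving maps\<close>

context nonatomic_measure_space
begin

text \<open>Repeated halving: a set of intermediate measure and its relative complement cannot both
  exceed half, so keeping a suitable one of them at least halves the measure each time.\<close>

lemma small_subset:
  assumes A: "A \<in> sets M" "emeasure M A > 0" and e: "(e::real) > 0"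
  shows "\<exists>B\<in>fmeasurable M. B \<subseteq> A \<and> 0 < measure M B \<and> measure M B < e"
proof -
  obtain B0 where B0: "B0 \<in> sets M" "B0 \<subseteq> A" "0 < emeasure M B0" "emeasure M B0 < emeasure M A"
    using nonatomic A by blast
  \<comment> \<open>Being strictly below \<open>emeasure M A\<close> forces finite measure even when
    \<open>A\<close> has infinite measure.\<close>
  have B0f: "B0 \<in> fmeasurable M"
    using B0 by (auto intro!: fmeasurableI simp: top.not_eq_extremum[symmetric] dest: less_imp_neq)
  have "\<exists>B\<in>fmeasurable M. B \<subseteq> A \<and> 0 < measure M B \<and> measure M B \<le> measure M B0 / 2 ^ n" for n :: nat
  proof (induction n)
    case 0
    then show ?case
      using B0 B0f by (auto intro!: bexI[of _ B0] simp: emeasure_eq_measure2)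
  next
    case (Suc n)
    then obtain B where B: "B \<in> fmeasurable M" "B \<subseteq> A" "0 < measure M B"
      "measure M B \<le> measure M B0 / 2 ^ n" by blast
    have "emeasure M B > 0" using B by (simp add: emeasure_eq_measure2)
    then obtain C where C: "C \<in> sets M" "C \<subseteq> B" "0 < emeasure M C" "emeasure M C < emeasure M B"
      using nonatomic B by (metis fmeasurableD)
    have Cf: "C \<in> fmeasurable M" using C B fmeasurableI2 by blast
    have m: "0 < measure M C" "measure M C < measure M B"
      using C B Cf by (auto simp: emeasure_eq_measure2 ennreal_less_iff)
    have d: "measure M (B - C) = measure M B - measure M C"
      using B Cf C by (simp add: measurable_measure_Diff fmeasurableD)
    show ?case
    proof (cases "measure M C \<le> measure M B / 2")
      case True
      with B C Cf m show ?thesis by (intro bexI[of _ C]) auto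
    next
      case False
      then have "measure M (B - C) \<le> measure M B / 2" using d by simp
      also have "\<dots> \<le> measure M B0 / 2 ^ Suc n" using B by simp
      finally show ?thesis
        using B Cf m d by (intro bexI[of _ "B - C"]) (auto intro: fmeasurable.Diff)
    qed
  qed
  moreover obtain n where "measure M B0 / e < 2 ^ n"
    using real_arch_pow[of 2 "measure M B0 / e"] by auto
  then have "measure M B0 / 2 ^ n < e" using e by (simp add: field_simps)
  ultimately show ?thesis by (meson order_le_less_trans)
qed

text \<open>Exhaustion by countably many enlargements of \<open>A\<close>, the n-th to within
  \<open>1/(n+1)\<close> of the best still possible under the bound \<open>t\<close>. Their union
  admits no further enlargement of positive measure, whereas \<open>small_subset\<close> would
  supply one if \<open>t\<close> were missed.\<close>

lemma intermediate_subset: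
  assumes A: "A \<in> sets M" and B: "B \<in> fmeasurable M" "A \<subseteq> B"
    and t: "measure M A \<le> t" "t \<le> measure M B"
  shows "\<exists>C\<in>sets M. A \<subseteq> C \<and> C \<subseteq> B \<and> measure M C = t"
proof -
  define P where "P = {C\<in>sets M. A \<subseteq> C \<and> C \<subseteq> B \<and> measure M C \<le> t}"
  have Pf: "C \<in> fmeasurable M" if "C \<in> P" for C
    using that B fmeasurableI2 unfolding P_def by blast
  \<comment> \<open>\<open>D\<close> comes within \<open>1/(n+1)\<close> of the supremum over all
    members of \<open>P\<close> above \<open>C\<close>. Whatever lies above \<open>D\<close> also
    lies above \<open>C\<close>, so no admissible enlargement of \<open>D\<close> gains that
    much.\<close>
  have step: "\<exists>D. D \<in> P \<and> C \<subseteq> D \<and> (\<forall>F\<in>P. D \<subseteq> F \<longrightarrow> measure M F < measure M D + inverse (real (Suc n)))"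
    if C: "C \<in> P" for C and n :: nat
  proof -
    let ?X = "measure M ` {D\<in>P. C \<subseteq> D}"
    have ne: "?X \<noteq> {}" using C by auto
    have bdd: "bdd_above ?X" by (auto simp: P_def bdd_above_def)
    have "Sup ?X - inverse (real (Suc n)) < Sup ?X" by simp
    from less_cSupE[OF this ne] obtain D where D: "D \<in> P" "C \<subseteq> D"
      "Sup ?X - inverse (real (Suc n)) < measure M D" by auto
    have "measure M F < measure M D + inverse (real (Suc n))" if "F \<in> P" "D \<subseteq> F" for F
    proof -
      have "measure M F \<le> Sup ?X" using that D by (intro cSup_upper bdd) auto
      then show ?thesis using D by simp
    qed
    with D show ?thesis by blast
  qed
  have "\<exists>S. \<forall>n. S n \<in> P \<and> (S n \<subseteq> S (Suc n) \<and>
      (\<forall>F\<in>P. S (Suc n) \<subseteq> F \<longrightarrow> measure M F < measure M (S (Suc n)) + inverse (real (Suc n))))"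
  proof (rule dependent_nat_choice)
    show "\<exists>C. C \<in> P" using assms by (auto simp: P_def)
  qed (use step in blast)
  then obtain S where S: "\<And>n. S n \<in> P" "\<And>n. S n \<subseteq> S (Suc n)"
    "\<And>n F. F \<in> P \<Longrightarrow> S (Suc n) \<subseteq> F \<Longrightarrow> measure M F < measure M (S (Suc n)) + inverse (real (Suc n))"
    by blast
  define T where "T = (\<Union>n. S n)"
  have T: "T \<in> sets M" "A \<subseteq> T" "T \<subseteq> B"
    using S(1) by (auto simp: T_def P_def)
  have Tf: "T \<in> fmeasurable M" using T B fmeasurableI2 by blast
  have lim: "(\<lambda>n. measure M (S n)) \<longlonglongrightarrow> measure M T"
    unfolding T_def
  proof (rule Lim_measure_incseq)
    show "range S \<subseteq> sets M" using S(1) by (auto simp: P_def)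
    show "incseq S" using S(2) by (simp add: incseq_Suc_iff)
    show "emeasure M (\<Union> (range S)) \<noteq> \<infinity>"
      using fmeasurableD2[OF Tf] by (simp add: T_def)
  qed
  have Tt: "measure M T \<le> t"
    by (rule LIMSEQ_le_const2[OF lim]) (use S(1) in \<open>auto simp: P_def\<close>)
  have "measure M T = t"
  proof (rule ccontr)
    assume "measure M T \<noteq> t"
    with Tt have lt: "t - measure M T > 0" by simp
    have dBT: "measure M (B - T) = measure M B - measure M T"
      using B Tf T by (simp add: measurable_measure_Diff fmeasurableD)
    have "emeasure M (B - T) > 0"
      using dBT lt t B Tf by (simp add: emeasure_eq_measure2 fmeasurable.Diff)
    then obtain D where D: "D \<in> fmeasurable M" "D \<subseteq> B - T" "0 < measure M D" "measure M D < t - measure M T"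
      using small_subset[OF _ _ lt, of "B - T"] B Tf by (meson fmeasurableD sets.Diff)
    have mU: "measure M (T \<union> D) = measure M T + measure M D"
      using D Tf by (intro measure_Un_AE) auto
    \<comment> \<open>\<open>D\<close> is smaller than the remaining gap, so the bound
      \<open>t\<close> survives. The union contains every \<open>S (Suc n)\<close>, so in the limit
      its gain over \<open>T\<close> would have to vanish.\<close>
    have "T \<union> D \<in> P"
      using D T Tf mU by (auto simp: P_def)
    then have "measure M (T \<union> D) < measure M (S (Suc n)) + inverse (real (Suc n))" for n
      by (intro S) (auto simp: T_def)
    then have "measure M (T \<union> D) \<le> measure M (S (Suc n)) + inverse (real (Suc n))" for n
      by (simp add: less_imp_le)
    moreover have "(\<lambda>n. measure M (S (Suc n)) + inverse (real (Suc n))) \<longlonglongrightarrow> measure M T + 0"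
      by (intro tendsto_add LIMSEQ_inverse_real_of_nat) (use lim LIMSEQ_Suc in blast)
    ultimately have "measure M (T \<union> D) \<le> measure M T + 0"
      by (intro LIMSEQ_le_const) auto
    with mU D show False by simp
  qed
  with T show ?thesis by blast
qed

text \<open>Each level arises from the previous one by inserting a midpoint into every gap with
  \<open>intermediate_subset\<close>; old sets get the even indices. The \<open>min 1\<close> lets
  \<open>k\<close> run over all naturals, the chain staying at \<open>D\<close> from index
  \<open>2 ^ n\<close> on.\<close>

lemma dyadic_chain:
  assumes D: "D \<in> fmeasurable M"
  obtains F :: "nat \<Rightarrow> nat \<Rightarrow> 'a set" where
    "\<And>n k. F n k \<in> sets M" "\<And>n k. F n k \<subseteq> D" "\<And>n. mono (F n)"
    "\<And>n k. F (Suc n) (2 * k) = F n k"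
    "\<And>n k. measure M (F n k) = min 1 (real k / 2 ^ n) * measure M D"
    "\<And>n. F n (2 ^ n) = D"
proof -
  define P where "P n F \<longleftrightarrow> (\<forall>k. F k \<in> sets M \<and> F k \<subseteq> D \<and> F k \<subseteq> F (Suc k) \<and>
    measure M (F k) = min 1 (real k / 2 ^ n) * measure M D) \<and> F (2 ^ n) = D" for n and F :: "nat \<Rightarrow> 'a set"
  have "\<exists>F. \<forall>n. P n (F n) \<and> (\<forall>k. F (Suc n) (2 * k) = F n k)"
  proof (rule dependent_nat_choice)
    show "\<exists>F. P 0 F"
      using D by (intro exI[of _ "\<lambda>k. if k = 0 then {} else D"]) (auto simp: P_def)
  next
    fix F :: "nat \<Rightarrow> 'a set" and n
    assume F: "P n F"
    have "\<exists>C\<in>sets M. F k \<subseteq> C \<and> C \<subseteq> F (Suc k) \<and>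
        measure M C = min 1 (real (2 * k + 1) / 2 ^ Suc n) * measure M D" for k
    proof (rule intermediate_subset)
      show "F (Suc k) \<in> fmeasurable M"
        using F D fmeasurableI2 unfolding P_def by blast
      have Fk: "measure M (F j) = min 1 (real j / 2 ^ n) * measure M D" for j
        using F by (simp add: P_def)
      have "real k / 2 ^ n \<le> real (2 * k + 1) / 2 ^ Suc n" "real (2 * k + 1) / 2 ^ Suc n \<le> real (Suc k) / 2 ^ n"
        by (simp_all add: field_simps)
      then show "measure M (F k) \<le> min 1 (real (2 * k + 1) / 2 ^ Suc n) * measure M D"
        "min 1 (real (2 * k + 1) / 2 ^ Suc n) * measure M D \<le> measure M (F (Suc k))"
        unfolding Fk by (intro mult_right_mono measure_nonneg; linarith)+
    qed (use F in \<open>auto simp: P_def\<close>)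
    then obtain C where C: "\<And>k. C k \<in> sets M" "\<And>k. F k \<subseteq> C k" "\<And>k. C k \<subseteq> F (Suc k)"
      "\<And>k. measure M (C k) = min 1 (real (2 * k + 1) / 2 ^ Suc n) * measure M D" by metis
    define G where "G k = (if even k then F (k div 2) else C (k div 2))" for k
    have "P (Suc n) G"
      unfolding P_def
    proof (intro conjI allI)
      fix k
      obtain j where j: "k = 2 * j \<or> k = Suc (2 * j)"
        by (metis evenE oddE Suc_eq_plus1)
      have G: "G (2 * j) = F j" "G (Suc (2 * j)) = C j" "G (Suc (Suc (2 * j))) = F (Suc j)" for j
        by (auto simp: G_def)
      have Fj: "F j \<in> sets M" "F (Suc j) \<subseteq> D" "F j \<subseteq> F (Suc j)"
        "measure M (F j) = min 1 (real j / 2 ^ n) * measure M D" for j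
        using F by (auto simp: P_def)
      show "G k \<in> sets M" using Fj C j by (auto simp: G)
      show "G k \<subseteq> D" using Fj C j by (auto simp: G) blast+
      show "G k \<subseteq> G (Suc k)" using C(2,3)[of j] j by (elim disjE) (simp_all only: G)
      show "measure M (G k) = min 1 (real k / 2 ^ Suc n) * measure M D"
        using Fj(4)[of j] C(4)[of j] j by (auto simp: G)
    qed (use F in \<open>auto simp: G_def P_def\<close>)
    moreover have "\<forall>k. G (2 * k) = F k" by (auto simp: G_def)
    ultimately show "\<exists>G. P (Suc n) G \<and> (\<forall>k. G (2 * k) = F k)" by blast
  qed
  then obtain F where F: "\<And>n. P n (F n)" "\<And>n k. F (Suc n) (2 * k) = F n k" by blast
  show thesis
  proof (rule that[of F])
    show "mono (F n)" for n
      using F(1)[of n] by (simp add: P_def mono_iff_le_Suc)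
  qed (use F in \<open>auto simp: P_def\<close>)
qed

text \<open>\<open>U\<close> is the rescaled dyadic index at which a point enters the chain. A
  strict sublevel set is the union of the chain members of smaller index, hence has proportional
  measure.\<close>

lemma uniform_function_finite:
  assumes D: "D \<in> fmeasurable M"
  obtains U :: "'a \<Rightarrow> real" where
    "\<And>t. {\<omega>\<in>D. U \<omega> < t} \<in> sets M" "\<And>\<omega>. \<omega> \<in> D \<Longrightarrow> 0 \<le> U \<omega>" "\<And>\<omega>. \<omega> \<in> D \<Longrightarrow> U \<omega> \<le> measure M D"
    "\<And>t. measure M {\<omega>\<in>D. U \<omega> < t} = min (measure M D) (max 0 t)"
proof -
  obtain F :: "nat \<Rightarrow> nat \<Rightarrow> 'a set" where F: 
    "\<And>n k. F n k \<in> sets M" "\<And>n k. F n k \<subseteq> D" "\<And>n. mono (F n)"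
    "\<And>n k. F (Suc n) (2 * k) = F n k"
    "\<And>n k. measure M (F n k) = min 1 (real k / 2 ^ n) * measure M D"
    "\<And>n. F n (2 ^ n) = D"
    using dyadic_chain[OF D] by metis
  have refine: "F (n + m) (2 ^ m * k) = F n k" for n m k
    by (induction m arbitrary: k) (auto simp: F(4) mult.assoc)
  \<comment> \<open>Both sets reappear at the common level \<open>n + n'\<close>, where monotonicity
    compares integer indices.\<close>
  have chain: "F n k \<subseteq> F n' k'" if "real k / 2 ^ n \<le> real k' / 2 ^ n'" for n k n' k'
  proof -
    have "real (2 ^ n' * k) \<le> real (2 ^ n * k')"
      using that by (simp add: field_simps)
    then have "2 ^ n' * k \<le> 2 ^ n * k'" by linarith
    then have "F (n + n') (2 ^ n' * k) \<subseteq> F (n + n') (2 ^ n * k')"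
      using F(3) by (meson monoD)
    then show ?thesis
      using refine[of n n' k] refine[of n' n k'] by (simp add: add.commute)
  qed
  define V where "V \<omega> = Inf {real k / 2 ^ n | n k. \<omega> \<in> F n k}" for \<omega>
  have V_less: "V \<omega> < t \<longleftrightarrow> (\<exists>n k. \<omega> \<in> F n k \<and> real k / 2 ^ n < t)" if "\<omega> \<in> D" for \<omega> t
  proof -
    have "{real k / 2 ^ n | n k. \<omega> \<in> F n k} \<noteq> {}"
      using F(6) that by blast
    moreover have "bdd_below {real k / 2 ^ n | n k. \<omega> \<in> F n k}"
      by (intro bdd_belowI[of _ 0]) auto
    ultimately show ?thesis
      unfolding V_def by (subst cInf_less_iff) auto
  qed
  have V_ge: "0 \<le> V \<omega>" if "\<omega> \<in> D" for \<omega>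
    using V_less[OF that, of 0] by (metis divide_nonneg_pos not_less of_nat_0_le_iff zero_less_numeral zero_less_power)
  have V_le: "V \<omega> \<le> 1" if "\<omega> \<in> D" for \<omega>
  proof (rule field_le_epsilon)
    fix e :: real assume "e > 0"
    have "\<omega> \<in> F 0 1" "real 1 / 2 ^ 0 < 1 + e"
      using that \<open>e > 0\<close> F(6)[of 0] by auto
    then have "V \<omega> < 1 + e"
      using V_less[OF that] by blast
    then show "V \<omega> \<le> 1 + e" by simp
  qed
  have V_eq: "{\<omega>\<in>D. V \<omega> < t} = (\<Union>(n, k)\<in>{(n, k). real k / 2 ^ n < t}. F n k)" for t
  proof (intro set_eqI)
    fix \<omega> show "\<omega> \<in> {\<omega>\<in>D. V \<omega> < t} \<longleftrightarrow> \<omega> \<in> (\<Union>(n, k)\<in>{(n, k). real k / 2 ^ n < t}. F n k)"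
      using V_less[of \<omega> t] F(2) by (cases "\<omega> \<in> D") auto
  qed
  have V_sets: "{\<omega>\<in>D. V \<omega> < t} \<in> sets M" for t
    unfolding V_eq using F(1) by (intro sets.countable_UN') auto
  have V_fm: "{\<omega>\<in>D. V \<omega> < t} \<in> fmeasurable M" for t
    by (rule fmeasurableI2[OF D _ V_sets]) auto
  \<comment> \<open>\<open>k\<close> is the first integer beyond \<open>s * 2 ^ n\<close>; a mesh
    finer than \<open>t - s\<close> keeps \<open>k / 2 ^ n\<close> below \<open>t\<close>.\<close>
  have approx: "\<exists>n k. s < real k / 2 ^ n \<and> real k / 2 ^ n < t" if "0 \<le> s" "s < t" for s t :: real
  proof -
    obtain n where n: "1 / (t - s) < 2 ^ n"
      using real_arch_pow[of 2 "1 / (t - s)"] by auto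
    define k where "k = nat \<lfloor>s * 2 ^ n\<rfloor> + 1"
    have "real k = of_int \<lfloor>s * 2 ^ n\<rfloor> + 1"
      using that by (simp add: k_def)
    then have "s * 2 ^ n < real k" "real k \<le> s * 2 ^ n + 1"
      by linarith+
    moreover have "s * 2 ^ n + 1 < t * 2 ^ n"
      using n that by (simp add: field_simps)
    ultimately show ?thesis
      by (intro exI[of _ n] exI[of _ k]) (simp add: field_simps)
  qed
  have V_measure: "measure M {\<omega>\<in>D. V \<omega> < t} = t * measure M D" if t: "0 \<le> t" "t \<le> 1" for t
  proof (rule antisym)
    \<comment> \<open>Otherwise a dyadic number fits strictly between \<open>t\<close> and the ratio
      of the measures; the chain set at that index contains the sublevel set but is too small for
      it. The reverse inequality is dual.\<close>
    show "measure M {\<omega>\<in>D. V \<omega> < t} \<le> t * measure M D"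
    proof (rule ccontr)
      assume "\<not> ?thesis"
      then have less: "t * measure M D < measure M {\<omega>\<in>D. V \<omega> < t}" by simp
      have "measure M {\<omega>\<in>D. V \<omega> < t} \<le> measure M D"
        using D V_sets by (intro measure_mono_fmeasurable) auto
      with less have "t * measure M D < measure M D" by simp
      then have pos: "measure M D > 0"
        using t by (metis less_eq_real_def measure_nonneg mult_zero_right less_irrefl)
      have "t < measure M {\<omega>\<in>D. V \<omega> < t} / measure M D"
        using less pos by (simp add: field_simps)
      then obtain n k where nk: "t < real k / 2 ^ n"
        "real k / 2 ^ n < measure M {\<omega>\<in>D. V \<omega> < t} / measure M D"
        using approx t by blast
      have "{\<omega>\<in>D. V \<omega> < t} \<subseteq> F n k"
      proof -
        have "F n' k' \<subseteq> F n k" if "real k' / 2 ^ n' < t" for n' k'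
          using nk that by (intro chain) simp
        then show ?thesis unfolding V_eq by auto
      qed
      then have "measure M {\<omega>\<in>D. V \<omega> < t} \<le> measure M (F n k)"
        using V_sets fmeasurableI2[OF D F(2) F(1)] by (intro measure_mono_fmeasurable) auto
      also have "\<dots> \<le> real k / 2 ^ n * measure M D"
        unfolding F(5) by (intro mult_right_mono) auto
      also have "\<dots> < measure M {\<omega>\<in>D. V \<omega> < t}"
        using nk pos by (simp add: field_simps)
      finally show False by simp
    qed
    show "t * measure M D \<le> measure M {\<omega>\<in>D. V \<omega> < t}"
    proof (rule ccontr)
      assume "\<not> ?thesis"
      then have less: "measure M {\<omega>\<in>D. V \<omega> < t} < t * measure M D" by simp
      then have pos: "measure M D > 0"
        by (metis measure_nonneg mult_zero_right not_less zero_less_measure_iff)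
      have "measure M {\<omega>\<in>D. V \<omega> < t} / measure M D < t"
        using less pos by (simp add: field_simps)
      then obtain n k where nk: "measure M {\<omega>\<in>D. V \<omega> < t} / measure M D < real k / 2 ^ n"
        "real k / 2 ^ n < t"
        using approx[of "measure M {\<omega>\<in>D. V \<omega> < t} / measure M D" t] by auto
      \<comment> \<open>At indices up to 1 the truncation \<open>min 1\<close> in the measure
        formula has no effect.\<close>
      have "real k / 2 ^ n \<le> 1" using nk(2) t(2) by linarith
      then have "real k / 2 ^ n * measure M D = measure M (F n k)"
        by (simp only: F(5) min_absorb2)
      also have "\<dots> \<le> measure M {\<omega>\<in>D. V \<omega> < t}"
        using nk F(1) V_fm by (intro measure_mono_fmeasurable) (auto simp: V_eq)
      also have "\<dots> < real k / 2 ^ n * measure M D"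
        using nk pos by (simp add: field_simps)
      finally show False by simp
    qed
  qed
  show thesis
  proof (rule that[of "\<lambda>\<omega>. measure M D * V \<omega>"])
    fix t
    have *: "{\<omega>\<in>D. measure M D * V \<omega> < t} \<in> sets M \<and> measure M {\<omega>\<in>D. measure M D * V \<omega> < t} = min (measure M D) (max 0 t)"
    proof -
      \<comment> \<open>Only the middle case divides by \<open>measure M D\<close>, which is
        positive there; a null set \<open>D\<close> falls under the two others.\<close>
      consider "t \<le> 0" | "0 < t" "t \<le> measure M D" | "0 < t" "measure M D < t" by linarith
      then show ?thesis
      proof cases
        case 1
        have "0 \<le> measure M D * V \<omega>" if "\<omega> \<in> D" for \<omega>
          using V_ge[OF that] by simp
        then have eq: "{\<omega>\<in>D. measure M D * V \<omega> < t} = {}"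
          using 1 by force
        show ?thesis unfolding eq using 1 by (simp add: max_absorb1 min_absorb2)
      next
        case 2
        then have eq: "{\<omega>\<in>D. measure M D * V \<omega> < t} = {\<omega>\<in>D. V \<omega> < t / measure M D}"
          by (auto simp: field_simps)
        show ?thesis unfolding eq using 2 V_sets V_measure[of "t / measure M D"]
          by (simp add: max_absorb2 min_absorb2)
      next
        case 3
        have "measure M D * V \<omega> \<le> measure M D" if "\<omega> \<in> D" for \<omega>
          using mult_left_mono[OF V_le[OF that], of "measure M D"] by simp
        then have eq: "{\<omega>\<in>D. measure M D * V \<omega> < t} = D"
          using 3 by force
        show ?thesis unfolding eq using 3 D by auto
      qed
    qed
    from * show "{\<omega>\<in>D. measure M D * V \<omega> < t} \<in> sets M" "measure M {\<omega>\<in>D. measure M D * V \<omega> < t} = min (measure M D) (max 0 t)" by auto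
  qed (use V_ge V_le in \<open>auto intro: mult_left_le\<close>)
qed

end

section \<open>Completion of restricted measures and lengths of initial segments\<close>

lemma completion_restrict_space:
  assumes "A \<in> sets M"
  shows "completion (restrict_space M A) = restrict_space (completion M) A"
proof (rule measure_eqI)
  have A: "A \<inter> space M \<in> sets M" "A \<in> sets (completion M)" using assms by auto
  show *: "sets (completion (restrict_space M A)) = sets (restrict_space (completion M) A)"
  proof (intro set_eqI iffI)
    fix X assume "X \<in> sets (completion (restrict_space M A))"
    then obtain S N N' where "X = S \<union> N" "N \<subseteq> N'" "N' \<in> null_sets M" "S \<in> sets M" "S \<subseteq> A" "N' \<subseteq> A"
      using assms by (auto elim!: sets_completionE simp: null_sets_restrict_space sets_restrict_space_iff)
    then show "X \<in> sets (restrict_space (completion M) A)"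
      using A by (auto simp: sets_restrict_space_iff intro: sets_completionI)
  next
    fix X assume "X \<in> sets (restrict_space (completion M) A)"
    then have X: "X \<subseteq> A" "X \<in> sets (completion M)"
      using A by (auto simp: sets_restrict_space_iff)
    then obtain S N N' where "X = S \<union> N" "N \<subseteq> N'" "N' \<in> null_sets M" "S \<in> sets M"
      by (auto elim!: sets_completionE)
    \<comment> \<open>The null cover \<open>N'\<close> may leave \<open>A\<close>, but
      \<open>N' \<inter> A\<close> still covers \<open>N\<close> because \<open>X\<close> lies in
      \<open>A\<close>.\<close>
    with X assms show "X \<in> sets (completion (restrict_space M A))"
      by (intro sets_completionI[of _ S N "N' \<inter> A"])
        (auto simp: null_sets_restrict_space sets_restrict_space_iff null_set_Int2)
  qed
  fix X assume X: "X \<in> sets (completion (restrict_space M A))"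
  then obtain S N N' where "X = S \<union> N" "N \<subseteq> N'" "N' \<in> null_sets (restrict_space M A)" "S \<in> sets (restrict_space M A)"
    by (auto elim!: sets_completionE)
  note S = this
  have "emeasure (completion (restrict_space M A)) X = emeasure (restrict_space M A) S"
    unfolding S(1) using S null_sets_completionI[OF S(3)]
    by (subst emeasure_Un_null_set) (auto intro: null_sets_completion_subset)
  also have "\<dots> = emeasure M S"
    using S assms by (auto simp: emeasure_restrict_space sets_restrict_space_iff)
  also have "\<dots> = emeasure (completion M) X"
  proof -
    have "N' \<in> null_sets M" using S assms by (simp add: null_sets_restrict_space)
    then have "N \<in> null_sets (completion M)"
      using S(2) by (metis null_sets_completionI null_sets_completion_subset)
    moreover have "S \<in> sets M" using S assms by (simp add: sets_restrict_space_iff)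
    ultimately show ?thesis unfolding S(1) by (subst emeasure_Un_null_set) auto
  qed
  also have "\<dots> = emeasure (restrict_space (completion M) A) X"
  proof -
    have "X \<subseteq> A" using X * A by (auto simp: sets_restrict_space_iff)
    then show ?thesis using A by (simp add: emeasure_restrict_space)
  qed
  finally show "emeasure (completion (restrict_space M A)) X = emeasure (restrict_space (completion M) A) X" .
qed

text \<open>The target for the map \<open>U\<close>: its sublevel sets must have these measures.
  Negative \<open>t\<close> fit in because \<open>ennreal t\<close> is then 0.\<close>

lemma emeasure_standard_interval_lessThan:
  "emeasure lborel (standard_interval M \<inter> {..<t}) = min (emeasure M (space M)) (ennreal t)"
proof (cases "emeasure M (space M) = \<infinity>")
  case True
  then have "standard_interval M \<inter> {..<t} = {0..<t}"
    by (auto simp: standard_interval_def)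
  then have "emeasure lborel (standard_interval M \<inter> {..<t}) = ennreal t"
    by (cases "0 \<le> t") (simp_all add: ennreal_neg)
  with True show ?thesis by simp
next
  case False
  define a where "a = measure M (space M)"
  have a: "emeasure M (space M) = ennreal a" "0 \<le> a" using False by (auto simp: a_def emeasure_eq_ennreal_measure)
  have I: "standard_interval M = {0..a}" using False by (simp add: standard_interval_def a_def)
  consider "t \<le> 0" | "0 < t" "t \<le> a" | "a < t" by linarith
  then show ?thesis
  proof cases
    case 1
    then have "standard_interval M \<inter> {..<t} = {}" by (auto simp: I)
    with 1 a show ?thesis by (simp add: ennreal_neg)
  next
    case 2
    then have "standard_interval M \<inter> {..<t} = {0..<t}" by (auto simp: I)
    with 2 a show ?thesis by (simp add: min_absorb2 ennreal_leI)
  next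
    case 3
    then have "standard_interval M \<inter> {..<t} = {0..a}" by (auto simp: I)
    with 3 a show ?thesis by (simp add: min_absorb1 ennreal_leI)
  qed
qed

lemma standard_interval_borel [measurable, simp]: "standard_interval M \<in> sets borel"
  by (simp add: standard_interval_def)

text \<open>Allows a map to be constructed into the Borel interval first and passed to the Lebesgue
  sets by completion afterwards.\<close>

lemma standard_space_eq_completion:
  "standard_space M = completion (restrict_space lborel (standard_interval M))"
  by (simp add: standard_space_def completion_restrict_space)

lemma space_standard_space [simp]: "space (standard_space M) = standard_interval M"
  by (simp add: standard_space_def space_restrict_space)

section \<open>Gluing finite pieces into a measure-preserving map\<close>

context nonatomic_measure_space
begin

text \<open>Disjoint pieces of finite measure are laid end to end: piece \<open>n\<close> is shifted
  by \<open>c n\<close>, the total measure of its predecessors. The offsets tend to the measure of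
  the whole space, so the total length is right also when it is infinite.\<close>

lemma uniform_function:
  obtains U :: "'a \<Rightarrow> real" where "U \<in> borel_measurable M" "U ` space M \<subseteq> standard_interval M"
    "\<And>t. emeasure M {\<omega>\<in>space M. U \<omega> < t} = min (emeasure M (space M)) (ennreal t)"
proof -
  obtain D where D: "range D \<subseteq> sets M" "(\<Union>i. D i) = space M"
      "\<And>i::nat. emeasure M (D i) \<noteq> \<infinity>" "disjoint_family D"
    using sigma_finite_disjoint by metis
  have Df: "D i \<in> fmeasurable M" for i
    using D by (auto simp: fmeasurable_def less_top)
  have "\<forall>i. \<exists>U. (\<forall>t. {\<omega>\<in>D i. U \<omega> < t} \<in> sets M) \<and> (\<forall>\<omega>\<in>D i. 0 \<le> U \<omega> \<and> U \<omega> \<le> measure M (D i)) \<and>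
    (\<forall>t. measure M {\<omega>\<in>D i. U \<omega> < t} = min (measure M (D i)) (max 0 t))"
  proof
    fix i
    show "\<exists>U. (\<forall>t. {\<omega>\<in>D i. U \<omega> < t} \<in> sets M) \<and> (\<forall>\<omega>\<in>D i. 0 \<le> U \<omega> \<and> U \<omega> \<le> measure M (D i)) \<and>
      (\<forall>t. measure M {\<omega>\<in>D i. U \<omega> < t} = min (measure M (D i)) (max 0 t))"
      by (rule uniform_function_finite[OF Df[of i]]) blast
  qed
  from choice[OF this] obtain V where V: "\<And>i t. {\<omega>\<in>D i. V i \<omega> < t} \<in> sets M"
    "\<And>i \<omega>. \<omega> \<in> D i \<Longrightarrow> 0 \<le> V i \<omega> \<and> V i \<omega> \<le> measure M (D i)"
    "\<And>i t. measure M {\<omega>\<in>D i. V i \<omega> < t} = min (measure M (D i)) (max 0 t)" by blast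
  define c where "c n = (\<Sum>i<n. measure M (D i))" for n
  define piece where "piece \<omega> = (THE n. \<omega> \<in> D n)" for \<omega>
  have piece: "piece \<omega> = n" if "\<omega> \<in> D n" for \<omega> n
    unfolding piece_def using that D(4) by (auto simp: disjoint_family_on_def)
  define U where "U \<omega> = c (piece \<omega>) + V (piece \<omega>) \<omega>" for \<omega>
  have U_less: "{\<omega>\<in>space M. U \<omega> < t} = (\<Union>n. {\<omega>\<in>D n. V n \<omega> < t - c n})" for t
    unfolding D(2)[symmetric] by (auto simp: U_def piece algebra_simps)
  have disj: "disjoint_family (\<lambda>n. {\<omega>\<in>D n. V n \<omega> < t - c n})" for t
    using D(4) unfolding disjoint_family_on_def by blast
  have c_nonneg: "0 \<le> c n" for n by (simp add: c_def sum_nonneg)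
  have c_sums: "(\<lambda>n. ennreal (c n)) \<longlonglongrightarrow> emeasure M (space M)"
  proof -
    have "(\<lambda>n. \<Sum>i<n. emeasure M (D i)) \<longlonglongrightarrow> (\<Sum>i. emeasure M (D i))"
      by (intro summable_LIMSEQ summableI)
    also have "(\<Sum>i. emeasure M (D i)) = emeasure M (space M)"
      using suminf_emeasure[OF D(1,4)] D(2) by simp
    also have "(\<lambda>n. \<Sum>i<n. emeasure M (D i)) = (\<lambda>n. ennreal (c n))"
      using Df by (auto simp: c_def emeasure_eq_measure2 sum_ennreal)
    finally show ?thesis .
  qed
  have c_le: "ennreal (c n) \<le> emeasure M (space M)" for n
    by (rule incseq_le[OF _ c_sums])
      (auto simp: incseq_Suc_iff c_def intro!: ennreal_leI)
  show thesis
  proof (rule that)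
    show "U \<in> borel_measurable M"
      unfolding borel_measurable_iff_less U_less using V(1) by auto
    show "U ` space M \<subseteq> standard_interval M"
    proof
      fix x assume "x \<in> U ` space M"
      then obtain \<omega> n where n: "\<omega> \<in> D n" "x = c n + V n \<omega>"
        unfolding D(2)[symmetric] by (auto simp: U_def piece)
      then have "0 \<le> x" "x \<le> c (Suc n)"
        using V(2)[of \<omega> n] c_nonneg[of n] by (auto simp: c_def)
      moreover have "x \<le> measure M (space M)" if "emeasure M (space M) \<noteq> \<infinity>"
      proof -
        have "ennreal (c (Suc n)) \<le> ennreal (measure M (space M))"
          using c_le[of "Suc n"] that by (simp add: emeasure_eq_ennreal_measure)
        then show ?thesis using \<open>x \<le> c (Suc n)\<close> by (simp add: ennreal_le_iff)
      qed
      ultimately show "x \<in> standard_interval M" by (auto simp: standard_interval_def)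
    qed
    fix t :: real
    \<comment> \<open>Pieces ending before \<open>t\<close> count fully and pieces starting after
      \<open>t\<close> not at all, so the truncated lengths add up to the truncated total.\<close>
    have partial: "(\<Sum>i<n. min (measure M (D i)) (max 0 (t - c i))) = min (c n) (max 0 t)" for n
    proof (induction n)
      case (Suc n)
      have "c (Suc n) = c n + measure M (D n)" by (simp add: c_def)
      with c_nonneg[of n] measure_nonneg[of M "D n"] show ?case
        unfolding sum.lessThan_Suc Suc.IH by linarith
    qed (simp add: c_def)
    have "emeasure M {\<omega>\<in>space M. U \<omega> < t} = (\<Sum>i. emeasure M {\<omega>\<in>D i. V i \<omega> < t - c i})"
      unfolding U_less using V(1) disj by (intro suminf_emeasure[symmetric]) auto
    also have "\<dots> = (\<Sum>i. ennreal (min (measure M (D i)) (max 0 (t - c i))))"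
    proof (rule suminf_cong)
      fix i
      have "{\<omega>\<in>D i. V i \<omega> < t - c i} \<in> fmeasurable M"
        by (rule fmeasurableI2[OF Df[of i] _ V(1)]) auto
      then show "emeasure M {\<omega>\<in>D i. V i \<omega> < t - c i} = ennreal (min (measure M (D i)) (max 0 (t - c i)))"
        using V(3) by (simp add: emeasure_eq_measure2)
    qed
    also have "\<dots> = min (emeasure M (space M)) (ennreal t)"
    proof (rule LIMSEQ_unique)
      show "(\<lambda>n. \<Sum>i<n. ennreal (min (measure M (D i)) (max 0 (t - c i))))
        \<longlonglongrightarrow> (\<Sum>i. ennreal (min (measure M (D i)) (max 0 (t - c i))))"
        by (intro summable_LIMSEQ summableI)
      have "(\<Sum>i<n. ennreal (min (measure M (D i)) (max 0 (t - c i)))) = min (ennreal (c n)) (ennreal t)" for n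
      proof -
        have "(\<Sum>i<n. ennreal (min (measure M (D i)) (max 0 (t - c i)))) = ennreal (min (c n) (max 0 t))"
          by (subst sum_ennreal) (auto simp: partial)
        also have "\<dots> = min (ennreal (c n)) (ennreal t)"
          using c_nonneg[of n] by (cases "0 \<le> t") (auto simp: ennreal_neg min_def ennreal_le_iff)
        finally show ?thesis .
      qed
      then show "(\<lambda>n. \<Sum>i<n. ennreal (min (measure M (D i)) (max 0 (t - c i))))
        \<longlonglongrightarrow> min (emeasure M (space M)) (ennreal t)"
        using c_sums by (simp add: tendsto_min)
    qed
    finally show "emeasure M {\<omega>\<in>space M. U \<omega> < t} = min (emeasure M (space M)) (ennreal t)" .
  qed
qed

text \<open>Agreement on half-lines, an intersection-stable generator, extends to all Borel sets.
  Preimages of Borel null sets are then null, and completeness of \<open>M\<close> carries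
  measurability and the image measure over to the Lebesgue sets.\<close>

lemma measure_preserving_map:
  obtains U where "U \<in> measurable M (standard_space M)"
    "distr M (standard_space M) U = standard_space M"
proof -
  obtain U :: "'a \<Rightarrow> real" where U [measurable]: "U \<in> borel_measurable M"
    and range: "U ` space M \<subseteq> standard_interval M"
    and less: "\<And>t. emeasure M {\<omega>\<in>space M. U \<omega> < t} = min (emeasure M (space M)) (ennreal t)"
    using uniform_function by blast
  define S where "S = restrict_space lborel (standard_interval M)"
  have U_S [measurable]: "U \<in> measurable M S"
    unfolding S_def using range by (intro measurable_restrict_space2) auto
  have id [measurable]: "(\<lambda>x. x) \<in> borel_measurable S"
    unfolding S_def by (intro measurable_restrict_space1) simp
  \<comment> \<open>Pushing \<open>S\<close> forward along the identity puts both measures on the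
    Borel sets of the whole line, where the half-lines generate.\<close>
  have "distr M borel U = distr S borel (\<lambda>x. x)"
  proof (rule measure_eqI_generator_eq_countable)
    let ?E = "range (\<lambda>a::real. {..<a})"
    have "{..<a} \<inter> {..<b} = {..<min a b}" for a b :: real by auto
    then show "Int_stable ?E" by (auto simp: Int_stable_def)
    show "?E \<subseteq> Pow UNIV" by simp
    have pre: "emeasure (distr M borel U) {..<t} = min (emeasure M (space M)) (ennreal t)" for t
    proof -
      have "U -` {..<t} \<inter> space M = {\<omega>\<in>space M. U \<omega> < t}" by auto
      then show ?thesis by (simp add: emeasure_distr less)
    qed
    show "emeasure (distr M borel U) X = emeasure (distr S borel (\<lambda>x. x)) X" if "X \<in> ?E" for X
    proof -
      obtain t where t: "X = {..<t}" using \<open>X \<in> ?E\<close> by auto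
      have "(\<lambda>x. x) -` X \<inter> space S = standard_interval M \<inter> {..<t}"
        by (auto simp: t S_def space_restrict_space)
      then have "emeasure (distr S borel (\<lambda>x. x)) X = emeasure S (standard_interval M \<inter> {..<t})"
        by (simp add: emeasure_distr t)
      also have "\<dots> = min (emeasure M (space M)) (ennreal t)"
        unfolding S_def by (subst emeasure_restrict_space) (auto simp: emeasure_standard_interval_lessThan)
      finally show ?thesis using pre t by simp
    qed
    show "sets (distr M borel U) = sigma_sets UNIV ?E" "sets (distr S borel (\<lambda>x. x)) = sigma_sets UNIV ?E"
      by (simp_all add: borel_Iio)
    show "(\<lambda>a::real. {..<a}) ` \<nat> \<subseteq> ?E" "countable ((\<lambda>a::real. {..<a}) ` \<nat>)"
      by (auto simp: Nats_def)
    show "\<Union> ((\<lambda>a::real. {..<a}) ` \<nat>) = UNIV"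
      using reals_Archimedean2 by (auto simp: Nats_def)
    show "emeasure (distr M borel U) a \<noteq> \<infinity>" if "a \<in> (\<lambda>a::real. {..<a}) ` \<nat>" for a
    proof -
      from that obtain t where "a = {..<t}" by auto
      then have "emeasure (distr M borel U) a \<le> ennreal t" by (simp add: pre)
      then show ?thesis by (auto simp: top_unique)
    qed
  qed
  have "distr M S U = S"
  proof (rule measure_eqI)
    fix A assume "A \<in> sets (distr M S U)"
    then have A: "A \<in> sets borel" "A \<subseteq> standard_interval M" "A \<in> sets S"
      by (auto simp: S_def sets_restrict_space_iff)
    have "emeasure (distr M S U) A = emeasure (distr M borel U) A"
      using A by (simp add: emeasure_distr)
    also have "\<dots> = emeasure S (A \<inter> space S)"
      using A by (simp add: \<open>distr M borel U = distr S borel (\<lambda>x. x)\<close> emeasure_distr)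
    also have "A \<inter> space S = A"
      using A sets.sets_into_space by blast
    finally show "emeasure (distr M S U) A = emeasure S A" .
  qed simp
  moreover have "standard_space M = completion S"
    by (simp add: S_def standard_space_eq_completion)
  ultimately show thesis
    using that[of U] measurable_completion2[OF U_S] completion_distr_eq[OF U_S] by simp
qed

end

section \<open>Distribution functions and rearrangements\<close>

lemma ae_class_eq_iff:
  assumes "f \<in> borel_measurable M" "g \<in> borel_measurable M"
  shows "ae_class M f = ae_class M g \<longleftrightarrow> (AE x in M. f x = g x)"
proof
  assume "ae_class M f = ae_class M g"
  moreover have "f \<in> ae_class M f" using assms by (simp add: ae_class_def)
  ultimately show "AE x in M. f x = g x" by (simp add: ae_class_def)
next
  assume "AE x in M. f x = g x"
  then show "ae_class M f = ae_class M g"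
    unfolding ae_class_def by (auto elim: AE_mp)
qed

lemma distribution_cong_AE:
  assumes [measurable]: "f \<in> borel_measurable M" "g \<in> borel_measurable M"
    and "AE x in M. f x = g x"
  shows "distribution M f = distribution M g"
  unfolding distribution_def
  by (intro ext emeasure_eq_AE) (use assms(3) in auto)

lemma distribution_le_space: "distribution M f y \<le> emeasure M (space M)"
  unfolding distribution_def by (rule emeasure_space)

lemma distribution_antimono:
  assumes [measurable]: "f \<in> borel_measurable M" and "y \<le> z"
  shows "distribution M f z \<le> distribution M f y"
  unfolding distribution_def using assms(2) by (intro emeasure_mono) auto

text \<open>A Galois connection between distribution function and rearrangement. The forward
  implication says that a finite infimum is attained, which is right-continuity of the distribution
  function.\<close>

lemma rearrangement_le_iff:
  assumes [measurable]: "f \<in> borel_measurable M" and "0 \<le> y"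
  shows "rearrangement M f x \<le> ennreal y \<longleftrightarrow> distribution M f y \<le> ennreal x"
proof
  assume "distribution M f y \<le> ennreal x"
  with \<open>0 \<le> y\<close> show "rearrangement M f x \<le> ennreal y"
    unfolding rearrangement_def by (intro INF_lower) auto
next
  assume le: "rearrangement M f x \<le> ennreal y"
  show "distribution M f y \<le> ennreal x"
  proof (rule ccontr)
    assume "\<not> ?thesis"
    \<comment> \<open>Continuity from below: the superlevel sets at \<open>y + 1/(n+1)\<close>
      increase to the one at \<open>y\<close>.\<close>
    moreover have "distribution M f y = (SUP n. distribution M f (y + inverse (real (Suc n))))"
    proof -
      have "{\<omega>\<in>space M. \<bar>f \<omega>\<bar> > y} = (\<Union>n. {\<omega>\<in>space M. \<bar>f \<omega>\<bar> > y + inverse (real (Suc n))})"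
      proof (intro set_eqI iffI)
        fix \<omega> assume w: "\<omega> \<in> {\<omega>\<in>space M. \<bar>f \<omega>\<bar> > y}"
        then obtain n where "inverse (real (Suc n)) < \<bar>f \<omega>\<bar> - y"
          using reals_Archimedean[of "\<bar>f \<omega>\<bar> - y"] by auto
        then have "y + inverse (real (Suc n)) < \<bar>f \<omega>\<bar>" by linarith
        then show "\<omega> \<in> (\<Union>n. {\<omega>\<in>space M. \<bar>f \<omega>\<bar> > y + inverse (real (Suc n))})"
          using w by blast
      next
        fix \<omega> assume "\<omega> \<in> (\<Union>n. {\<omega>\<in>space M. \<bar>f \<omega>\<bar> > y + inverse (real (Suc n))})"
        then obtain n where "\<omega> \<in> space M" "\<bar>f \<omega>\<bar> > y + inverse (real (Suc n))" by blast
        moreover have "inverse (real (Suc n)) > 0" by simp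
        ultimately have "\<bar>f \<omega>\<bar> > y" by linarith
        with \<open>\<omega> \<in> space M\<close> show "\<omega> \<in> {\<omega>\<in>space M. \<bar>f \<omega>\<bar> > y}" by simp
      qed
      moreover have "incseq (\<lambda>n. {\<omega>\<in>space M. \<bar>f \<omega>\<bar> > y + inverse (real (Suc n))})"
      proof (intro incseq_SucI subsetI)
        fix n \<omega> assume "\<omega> \<in> {\<omega>\<in>space M. \<bar>f \<omega>\<bar> > y + inverse (real (Suc n))}"
        moreover have "inverse (real (Suc (Suc n))) \<le> inverse (real (Suc n))"
          by (rule le_imp_inverse_le) auto
        ultimately show "\<omega> \<in> {\<omega>\<in>space M. \<bar>f \<omega>\<bar> > y + inverse (real (Suc (Suc n)))}"
          unfolding mem_Collect_eq by linarith
      qed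
      ultimately show ?thesis
        unfolding distribution_def by (subst SUP_emeasure_incseq) auto
    qed
    ultimately obtain n where n: "ennreal x < distribution M f (y + inverse (real (Suc n)))"
      by (auto simp: not_le less_SUP_iff)
    \<comment> \<open>Although \<open>z > y\<close>, its distribution value is still too large. By
      monotonicity nothing admissible lies below \<open>z\<close>, so the infimum is at least
      \<open>z\<close>.\<close>
    define z where "z = y + inverse (real (Suc n))"
    have "ennreal z \<le> rearrangement M f x"
      unfolding rearrangement_def
    proof (rule INF_greatest)
      fix w assume w: "w \<in> {w. 0 \<le> w \<and> distribution M f w \<le> ennreal x}"
      have "z \<le> w"
      proof (rule ccontr)
        assume "\<not> z \<le> w"
        then have "distribution M f z \<le> distribution M f w"
          by (intro distribution_antimono) auto
        with n w show False by (auto simp: z_def)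
      qed
      then show "ennreal z \<le> ennreal w" by (rule ennreal_leI)
    qed
    with le have "ennreal z \<le> ennreal y" by simp
    with \<open>0 \<le> y\<close> have "z \<le> y" by (simp add: ennreal_le_iff)
    moreover have "inverse (real (Suc n)) > 0" by simp
    ultimately show False by (simp add: z_def)
  qed
qed

lemma less_rearrangement_iff:
  assumes "f \<in> borel_measurable M" "0 \<le> y"
  shows "ennreal y < rearrangement M f x \<longleftrightarrow> ennreal x < distribution M f y"
  using rearrangement_le_iff[OF assms, of x] by (simp add: not_le[symmetric])

lemma rearrangement_cong:
  assumes "\<And>y. 0 \<le> y \<Longrightarrow> distribution M f y = distribution M' g y"
  shows "rearrangement M f = rearrangement M' g"
proof -
  have "{y. 0 \<le> y \<and> distribution M f y \<le> ennreal x} = {y. 0 \<le> y \<and> distribution M' g y \<le> ennreal x}" for x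
    using assms by auto
  then show ?thesis unfolding rearrangement_def by presburger
qed

text \<open>Evaluating at the point \<open>x\<close> given by \<open>distribution M f y\<close> and
  applying the Galois connection twice recovers the distribution function. A finite such value is at
  most the total measure, so \<open>x\<close> lies in the interval.\<close>

lemma distribution_le_if_rearrangement_le:
  assumes f: "f \<in> borel_measurable M" and g: "g \<in> borel_measurable M'"
    and le: "\<And>x. x \<in> standard_interval M \<Longrightarrow> rearrangement M' g x \<le> rearrangement M f x"
    and y: "0 \<le> y"
  shows "distribution M' g y \<le> distribution M f y"
proof (cases "distribution M f y = \<infinity>")
  case False
  define x where "x = enn2real (distribution M f y)"
  have x: "distribution M f y = ennreal x" "0 \<le> x"
    using False by (simp_all add: x_def less_top)
  have "x \<in> standard_interval M"
  proof (cases "emeasure M (space M) = \<infinity>")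
    case True
    with x show ?thesis by (simp add: standard_interval_def)
  next
    case fin: False
    then have "ennreal x \<le> ennreal (measure M (space M))"
      using distribution_le_space[of M f y] x by (simp add: emeasure_eq_ennreal_measure)
    with x fin show ?thesis by (simp add: standard_interval_def ennreal_le_iff)
  qed
  moreover have "rearrangement M f x \<le> ennreal y"
    using rearrangement_le_iff[OF f y] x by simp
  ultimately have "rearrangement M' g x \<le> ennreal y"
    using le order_trans by blast
  then show ?thesis
    using rearrangement_le_iff[OF g y] x by simp
qed simp

section \<open>Rearrangements as functions on the standard interval\<close>

lemma emeasure_standard_space:
  assumes "A \<in> sets borel" "A \<subseteq> standard_interval M"
  shows "emeasure (standard_space M) A = emeasure lborel A"
  using assms by (simp add: standard_space_def emeasure_restrict_space)

lemma sets_standard_space: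
  assumes "A \<in> sets borel" "A \<subseteq> standard_interval M"
  shows "A \<in> sets (standard_space M)"
  using assms by (simp add: standard_space_def sets_restrict_space_iff)

text \<open>Supplies a segment of any admissible measure. The bound \<open>t\<close> is extended
  because distribution functions may be infinite.\<close>

lemma emeasure_standard_space_less:
  assumes "t \<le> emeasure M (space M)"
  shows "{x\<in>standard_interval M. ennreal x < t} \<in> sets (standard_space M)"
    and "emeasure (standard_space M) {x\<in>standard_interval M. ennreal x < t} = t"
proof -
  have *: "{x\<in>standard_interval M. ennreal x < t} \<in> sets borel \<and>
    emeasure lborel {x\<in>standard_interval M. ennreal x < t} = t"
  proof (cases t rule: ennreal_cases)
    case (real r)
    have "{x\<in>standard_interval M. ennreal x < t} = standard_interval M \<inter> {..<r}"
      using real by (auto simp: standard_interval_def ennreal_less_iff split: if_splits)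
    with real assms show ?thesis
      by (simp add: emeasure_standard_interval_lessThan min_absorb2)
  next
    case top
    then have inf: "emeasure M (space M) = \<infinity>" using assms by (simp add: top_unique)
    have le: "ennreal r \<le> emeasure lborel (standard_interval M)" for r
    proof -
      have "emeasure lborel (standard_interval M \<inter> {..<r}) \<le> emeasure lborel (standard_interval M)"
        by (intro emeasure_mono) auto
      then show ?thesis using inf by (simp add: emeasure_standard_interval_lessThan)
    qed
    have "emeasure lborel (standard_interval M) = \<infinity>"
    proof (rule ccontr)
      assume "emeasure lborel (standard_interval M) \<noteq> \<infinity>"
      then obtain r where "0 \<le> r" "emeasure lborel (standard_interval M) = ennreal r"
        by (cases "emeasure lborel (standard_interval M)" rule: ennreal_cases) auto
      with le[of "r + 1"] show False by (simp add: ennreal_le_iff)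
    qed
    with top show ?thesis by simp
  qed
  then show "{x\<in>standard_interval M. ennreal x < t} \<in> sets (standard_space M)"
    "emeasure (standard_space M) {x\<in>standard_interval M. ennreal x < t} = t"
    by (auto intro: sets_standard_space simp: emeasure_standard_space)
qed

lemma emeasure_space_standard_space:
  "emeasure (standard_space M) (standard_interval M) = emeasure M (space M)"
proof (rule antisym)
  show "emeasure M (space M) \<le> emeasure (standard_space M) (standard_interval M)"
    using emeasure_standard_space_less[of "emeasure M (space M)" M]
      emeasure_space[of "standard_space M" "{x\<in>standard_interval M. ennreal x < emeasure M (space M)}"]
    by simp
  show "emeasure (standard_space M) (standard_interval M) \<le> emeasure M (space M)"
  proof (cases "emeasure M (space M) = \<infinity>")
    case False
    then have "standard_interval M = {0..measure M (space M)}" by (simp add: standard_interval_def)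
    then have "emeasure lborel (standard_interval M) = emeasure M (space M)"
      using False by (simp add: emeasure_eq_ennreal_measure)
    then show ?thesis by (simp add: emeasure_standard_space)
  qed simp
qed

lemma standard_interval_standard_space [simp]:
  "standard_interval (standard_space M) = standard_interval M"
proof -
  have e: "emeasure (standard_space M) (space (standard_space M)) = emeasure M (space M)"
    by (simp add: emeasure_space_standard_space)
  then have "measure (standard_space M) (space (standard_space M)) = measure M (space M)"
    by (simp only: measure_def)
  with e show ?thesis
    by (simp only: standard_interval_def[of "standard_space M"] standard_interval_def[of M])
qed

text \<open>Places the rearrangement classes coming from \<open>M\<close> and from its standard
  space in one and the same \<open>L0\<close>, so that the two \<open>Xi\<close> sets can be
  compared.\<close>

lemma standard_space_idem [simp]: "standard_space (standard_space M) = standard_space M"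
proof -
  have "standard_space (standard_space M) = lebesgue_on (standard_interval (standard_space M))"
    by (rule standard_space_def)
  also have "\<dots> = lebesgue_on (standard_interval M)"
    by (simp only: standard_interval_standard_space)
  finally show ?thesis by (simp only: standard_space_def[of M])
qed

text \<open>Trades rearrangements for distribution functions, the form in which the symmetry axiom
  is stated. The forward direction is the comparison of distributions applied both ways.\<close>

lemma same_rearrangement_iff:
  assumes "g \<in> borel_measurable (standard_space M)" "f \<in> borel_measurable M"
  shows "same_rearrangement M g f \<longleftrightarrow>
    (\<forall>y\<ge>0. distribution (standard_space M) g y = distribution M f y)"
proof
  assume "same_rearrangement M g f"
  then show "\<forall>y\<ge>0. distribution (standard_space M) g y = distribution M f y"
    using assms unfolding same_rearrangement_def
    by (auto intro!: antisym distribution_le_if_rearrangement_le)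
next
  assume "\<forall>y\<ge>0. distribution (standard_space M) g y = distribution M f y"
  then show "same_rearrangement M g f"
    unfolding same_rearrangement_def using rearrangement_cong[of "standard_space M" g M f] by simp
qed

text \<open>By the Galois connection, superlevel sets of the rearrangement are initial segments of
  length \<open>distribution M f y\<close>; this is the equimeasurability of \<open>f\<close> with
  its rearrangement.\<close>

lemma
  assumes f: "f \<in> borel_measurable M" and y: "0 \<le> y"
  shows rearrangement_superlevel_sets:
      "{x\<in>standard_interval M. ennreal y < rearrangement M f x} \<in> sets (standard_space M)"
    and emeasure_rearrangement_superlevel:
      "emeasure (standard_space M) {x\<in>standard_interval M. ennreal y < rearrangement M f x} = distribution M f y"
  unfolding less_rearrangement_iff[OF assms]
  by (rule emeasure_standard_space_less distribution_le_space)+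

lemma measurable_rearrangement [measurable]:
  assumes "f \<in> borel_measurable M"
  shows "rearrangement M f \<in> borel_measurable (standard_space M)"
proof (rule borel_measurableI_greater)
  fix y :: ennreal
  show "{x \<in> space (standard_space M). y < rearrangement M f x} \<in> sets (standard_space M)"
    by (cases y rule: ennreal_cases) (simp_all add: rearrangement_superlevel_sets assms)
qed

text \<open>\<open>enn2real\<close> sends \<infinity> to 0 and would lose the points of infinite
  value; \<open>fin\<close> makes these a null set.\<close>

lemma distribution_enn2real_rearrangement:
  assumes f [measurable]: "f \<in> borel_measurable M" and y: "0 \<le> y"
    and fin: "AE x in standard_space M. rearrangement M f x < \<infinity>"
  shows "distribution (standard_space M) (\<lambda>x. enn2real (rearrangement M f x)) y = distribution M f y"
proof -
  have iff: "y < \<bar>enn2real r\<bar> \<longleftrightarrow> ennreal y < r" if "r < \<infinity>" for r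
    using that y by (cases r rule: ennreal_cases) (auto simp: ennreal_less_iff)
  have "distribution (standard_space M) (\<lambda>x. enn2real (rearrangement M f x)) y
    = emeasure (standard_space M) {x\<in>space (standard_space M). ennreal y < rearrangement M f x}"
    unfolding distribution_def
  proof (rule emeasure_eq_AE)
    show "AE x in standard_space M. x \<in> {x\<in>space (standard_space M). y < \<bar>enn2real (rearrangement M f x)\<bar>} \<longleftrightarrow>
      x \<in> {x\<in>space (standard_space M). ennreal y < rearrangement M f x}"
      using fin
    proof eventually_elim
      case (elim x)
      from iff[OF this] show ?case by simp
    qed
  qed measurable
  then show ?thesis
    using emeasure_rearrangement_superlevel[OF f y] by simp
qed

section \<open>Non-atomicity of the standard space\<close>

lemma sigma_finite_measure_completion:
  assumes "sigma_finite_measure M"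
  shows "sigma_finite_measure (completion M)"
proof
  interpret sigma_finite_measure M by fact
  obtain A where A: "countable A" "A \<subseteq> sets M" "\<Union>A = space M" "\<forall>a\<in>A. emeasure M a \<noteq> \<infinity>"
    using sigma_finite_countable by blast
  then show "\<exists>A. countable A \<and> A \<subseteq> sets (completion M) \<and>
      \<Union>A = space (completion M) \<and> (\<forall>a\<in>A. emeasure (completion M) a \<noteq> \<infinity>)"
    by (intro exI[of _ A]) (auto simp: subset_iff)
qed

text \<open>Slice \<open>A\<close> into pieces of width \<open>d\<close>, a positive number below
  the measure of \<open>A\<close>. Countably many null slices cannot make up \<open>A\<close>, so
  some slice has positive measure, and this is at most \<open>d\<close>.\<close>

lemma (in nonatomic_measure_space) nonatomic_standard_space:
  "nonatomic_measure_space (standard_space M)"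
proof -
  let ?S = "standard_space M"
  interpret S: complete_measure ?S
    unfolding standard_space_eq_completion ..
  interpret S: sigma_finite_measure ?S
    unfolding standard_space_def
    by (intro sigma_finite_measure_restrict_space sigma_finite_measure_completion) (auto intro: sigma_finite_lborel)
  show ?thesis
  proof
    show "0 < emeasure ?S (space ?S)"
      using space_pos by (simp add: emeasure_space_standard_space)
    fix A assume A: "A \<in> sets ?S" "0 < emeasure ?S A"
    obtain e where e: "0 < e" "e < emeasure ?S A"
      using dense[OF A(2)] by blast
    then obtain d where d: "0 < d" "ennreal d < emeasure ?S A"
      by (cases e rule: ennreal_cases) auto
    define B where "B k = A \<inter> {real k * d..<real (Suc k) * d}" for k
    have I: "{real k * d..<real (Suc k) * d} \<inter> standard_interval M \<in> sets ?S" for k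
      by (intro sets_standard_space) auto
    have AI: "A \<subseteq> standard_interval M" using sets.sets_into_space[OF A(1)] by simp
    have B: "B k \<in> sets ?S" for k
    proof -
      have "B k = A \<inter> ({real k * d..<real (Suc k) * d} \<inter> standard_interval M)"
        using AI by (auto simp: B_def)
      then show ?thesis using A(1) I by auto
    qed
    have B_le: "emeasure ?S (B k) \<le> ennreal d" for k
    proof -
      have "emeasure ?S (B k) \<le> emeasure ?S ({real k * d..<real (Suc k) * d} \<inter> standard_interval M)"
        using AI I by (intro emeasure_mono) (auto simp: B_def)
      also have "\<dots> = emeasure lborel ({real k * d..<real (Suc k) * d} \<inter> standard_interval M)"
        by (intro emeasure_standard_space) auto
      also have "\<dots> \<le> emeasure lborel {real k * d..<real (Suc k) * d}"
        by (intro emeasure_mono) auto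
      also have "\<dots> = ennreal d" using d by (simp add: algebra_simps)
      finally show ?thesis .
    qed
    have "A = (\<Union>k. B k)"
    proof -
      have "\<exists>k. real k * d \<le> x \<and> x < real (Suc k) * d" if "x \<in> A" for x
      proof -
        have "0 \<le> x" using that AI by (auto simp: standard_interval_def split: if_splits)
        then have "real (nat \<lfloor>x / d\<rfloor>) = of_int \<lfloor>x / d\<rfloor>" using d by simp
        then have "real (nat \<lfloor>x / d\<rfloor>) \<le> x / d" "x / d < real (Suc (nat \<lfloor>x / d\<rfloor>))" by linarith+
        then show ?thesis using d by (metis mult.commute pos_divide_less_eq pos_le_divide_eq)
      qed
      then show ?thesis by (auto simp: B_def)
    qed
    moreover have "\<exists>k. emeasure ?S (B k) \<noteq> 0"
    proof (rule ccontr)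
      assume "\<nexists>k. emeasure ?S (B k) \<noteq> 0"
      then have "(\<Union>k. B k) \<in> null_sets ?S" using B by (intro null_sets_UN) auto
      with \<open>A = (\<Union>k. B k)\<close> A(2) show False by auto
    qed
    then obtain k where "0 < emeasure ?S (B k)" by (auto simp: zero_less_iff_neq_zero)
    then show "\<exists>B\<in>sets ?S. B \<subseteq> A \<and> 0 < emeasure ?S B \<and> emeasure ?S B < emeasure ?S A"
      using B B_le[of k] d by (intro bexI[of _ "B k"]) (auto simp: B_def)
  qed
qed

section \<open>Transport to the standard space\<close>

lemma distribution_indicator:
  assumes "A \<in> sets M" "0 \<le> y"
  shows "distribution M (indicator A) y = (if y < 1 then emeasure M A else 0)"
proof -
  have "{\<omega> \<in> space M. \<bar>indicator A \<omega>\<bar> > y} = (if y < 1 then A else {})"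
    using assms sets.sets_into_space[OF assms(1)] by (auto simp: indicator_def split: if_splits)
  then show ?thesis by (simp add: distribution_def)
qed

context symmetric_space
begin

lemma mem_E_obtain:
  assumes "F \<in> E"
  obtains f where "f \<in> borel_measurable M" "F = ae_class M f"
  using assms subset_L0 by (auto simp: L0_def)

text \<open>The definite description is single-valued: a rearrangement class determines the
  distribution function, and by symmetry this determines the norm.\<close>

lemma Xi_norm_eq:
  assumes f: "f \<in> borel_measurable M" "ae_class M f \<in> E"
    and fin: "AE x in standard_space M. rearrangement M f x < \<infinity>"
  shows "Xi_norm M E N (rearrangement_class M f) = N (ae_class M f)"
  unfolding Xi_norm_def
proof (rule the_equality)
  show "\<exists>g\<in>borel_measurable M. ae_class M g \<in> E \<and> (AE x in standard_space M. rearrangement M g x < \<infinity>) \<and>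
    rearrangement_class M f = rearrangement_class M g \<and> N (ae_class M f) = N (ae_class M g)"
    using assms by blast
next
  fix r
  assume "\<exists>g\<in>borel_measurable M. ae_class M g \<in> E \<and> (AE x in standard_space M. rearrangement M g x < \<infinity>) \<and>
    rearrangement_class M f = rearrangement_class M g \<and> r = N (ae_class M g)"
  then obtain g where g: "g \<in> borel_measurable M" "ae_class M g \<in> E"
    "AE x in standard_space M. rearrangement M g x < \<infinity>"
    "rearrangement_class M f = rearrangement_class M g" "r = N (ae_class M g)" by blast
  note [measurable] = f(1) g(1)
  have "AE x in standard_space M. enn2real (rearrangement M f x) = enn2real (rearrangement M g x)"
    using g(4) unfolding rearrangement_class_def by (subst (asm) ae_class_eq_iff) auto
  then have "distribution (standard_space M) (\<lambda>x. enn2real (rearrangement M f x)) =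
      distribution (standard_space M) (\<lambda>x. enn2real (rearrangement M g x))"
    by (intro distribution_cong_AE) auto
  then have "distribution M g y = distribution M f y" if "0 \<le> y" for y
    using that distribution_enn2real_rearrangement[OF f(1) that fin]
      distribution_enn2real_rearrangement[OF g(1) that g(3)] by simp
  with f g show "r = N (ae_class M f)"
    using symmetric[of g f] by simp
qed

end

text \<open>\<open>U\<close> is only a tool: \<open>standard_E\<close> and
  \<open>standard_norm\<close> do not mention it, so conclusions about them reached with one choice
  of \<open>U\<close> are independent of that choice.\<close>

locale symmetric_space_transport = symmetric_space +
  fixes U
  assumes U [measurable]: "U \<in> measurable M (standard_space M)"
    and distr_U: "distr M (standard_space M) U = standard_space M"
begin

abbreviation S where "S \<equiv> standard_space M"
abbreviation pull where "pull g \<equiv> ae_class M (\<lambda>\<omega>. g (U \<omega>))"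

lemma AE_comp_iff:
  assumes "{x\<in>space S. P x} \<in> sets S"
  shows "(AE x in S. P x) \<longleftrightarrow> (AE \<omega> in M. P (U \<omega>))"
  by (rule AE_distr_iff[OF U assms, unfolded distr_U])

lemma distribution_comp:
  assumes [measurable]: "g \<in> borel_measurable S"
  shows "distribution M (\<lambda>\<omega>. g (U \<omega>)) = distribution S g"
proof
  fix y
  have "{x\<in>space S. \<bar>g x\<bar> > y} \<in> sets S" by measurable
  moreover have "U -` {x\<in>space S. \<bar>g x\<bar> > y} \<inter> space M = {\<omega>\<in>space M. \<bar>g (U \<omega>)\<bar> > y}"
    using measurable_space[OF U] by auto
  ultimately show "distribution M (\<lambda>\<omega>. g (U \<omega>)) y = distribution S g y"
    unfolding distribution_def using emeasure_distr[OF U] by (metis distr_U)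
qed

text \<open>Any witness \<open>f\<close> has the distribution of \<open>g\<close>, hence that of the
  pullback of \<open>g\<close>, so symmetry puts the pullback into \<open>E\<close>. Conversely the
  pullback is itself a witness.\<close>

lemma mem_standard_E_iff:
  assumes g [measurable]: "g \<in> borel_measurable S"
  shows "ae_class S g \<in> standard_E M E \<longleftrightarrow> pull g \<in> E"
proof
  assume "ae_class S g \<in> standard_E M E"
  then obtain g' f where g' [measurable]: "g' \<in> borel_measurable S" and f: "f \<in> borel_measurable M" "ae_class M f \<in> E"
    and eq: "ae_class S g = ae_class S g'" "same_rearrangement M g' f"
    unfolding standard_E_def by auto
  have "distribution S g = distribution S g'"
    using eq(1) by (intro distribution_cong_AE) (simp_all add: ae_class_eq_iff)
  with eq(2) f have "\<forall>y\<ge>0. distribution M (\<lambda>\<omega>. g (U \<omega>)) y = distribution M f y"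
    by (simp add: same_rearrangement_iff distribution_comp)
  then show "pull g \<in> E"
    using symmetric[of "\<lambda>\<omega>. g (U \<omega>)" f] f by simp
next
  assume "pull g \<in> E"
  moreover have "same_rearrangement M g (\<lambda>\<omega>. g (U \<omega>))"
    by (subst same_rearrangement_iff) (simp_all add: distribution_comp)
  ultimately show "ae_class S g \<in> standard_E M E"
    unfolding standard_E_def using g by (auto intro!: exI[of _ g] bexI[of _ "\<lambda>\<omega>. g (U \<omega>)"])
qed

lemma mem_standard_E_obtain:
  assumes "G \<in> standard_E M E"
  obtains g where "g \<in> borel_measurable S" "G = ae_class S g" "pull g \<in> E"
proof -
  obtain g where g: "g \<in> borel_measurable S" "G = ae_class S g"
    using assms unfolding standard_E_def by blast
  with assms that show thesis by (simp add: mem_standard_E_iff)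
qed

text \<open>Well-definedness: all representatives of the class and all their witnesses share one
  distribution function, so symmetry leaves a single value.\<close>

lemma standard_norm_eq:
  assumes g [measurable]: "g \<in> borel_measurable S" and f [measurable]: "f \<in> borel_measurable M"
    and E: "ae_class M f \<in> E" and same: "same_rearrangement M g f"
  shows "standard_norm M E N (ae_class S g) = N (ae_class M f)"
  unfolding standard_norm_def
proof (rule the_equality)
  show "\<exists>g'\<in>borel_measurable S. \<exists>f'\<in>borel_measurable M. ae_class S g = ae_class S g' \<and>
    ae_class M f' \<in> E \<and> same_rearrangement M g' f' \<and> N (ae_class M f) = N (ae_class M f')"
    using assms by blast
next
  fix r
  assume "\<exists>g'\<in>borel_measurable S. \<exists>f'\<in>borel_measurable M. ae_class S g = ae_class S g' \<and>
    ae_class M f' \<in> E \<and> same_rearrangement M g' f' \<and> r = N (ae_class M f')"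
  then obtain g' f' where [measurable]: "g' \<in> borel_measurable S" "f' \<in> borel_measurable M"
    and eq: "ae_class S g = ae_class S g'" "ae_class M f' \<in> E" "same_rearrangement M g' f'" "r = N (ae_class M f')"
    by blast
  have "distribution S g = distribution S g'"
    using eq(1) by (intro distribution_cong_AE) (simp_all add: ae_class_eq_iff)
  with same eq(3) have "\<forall>y\<ge>0. distribution M f' y = distribution M f y"
    by (simp add: same_rearrangement_iff)
  then show "r = N (ae_class M f)"
    using symmetric[of f' f] E eq(4) by simp
qed

lemma standard_norm_pull:
  assumes g [measurable]: "g \<in> borel_measurable S" and "pull g \<in> E"
  shows "standard_norm M E N (ae_class S g) = N (pull g)"
proof (rule standard_norm_eq)
  show "same_rearrangement M g (\<lambda>\<omega>. g (U \<omega>))"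
    by (subst same_rearrangement_iff) (simp_all add: distribution_comp)
qed (use assms in simp_all)

section \<open>From convergence in norm to convergence almost everywhere\<close>

definition initial where "initial t = {x\<in>space S. ennreal x < t}"

lemma initial_sets [measurable]: "t \<le> emeasure M (space M) \<Longrightarrow> initial t \<in> sets S"
  unfolding initial_def using emeasure_standard_space_less(1) by simp

lemma initial_emeasure: "t \<le> emeasure M (space M) \<Longrightarrow> emeasure S (initial t) = t"
  unfolding initial_def using emeasure_standard_space_less(2) by simp

text \<open>
  By symmetry, indicators of arbitrary sets may be replaced by indicators of the preimages of
  initial segments of the standard interval, and these form a chain.
\<close>

lemma Chebyshev_initial:
  assumes f [measurable]: "f \<in> borel_measurable M" and E: "ae_class M f \<in> E"
    and e: "0 < e" and t: "t \<le> distribution M f e"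
  shows "pull (indicator (initial t)) \<in> E"
    and "e * N (pull (indicator (initial t))) \<le> N (ae_class M f)"
proof -
  define A where "A = {\<omega>\<in>space M. \<bar>f \<omega>\<bar> > e}"
  define s where "s = emeasure M A"
  have A [measurable]: "A \<in> sets M" unfolding A_def by measurable
  have s: "s = distribution M f e" by (simp add: s_def A_def distribution_def)
  have s_le: "s \<le> emeasure M (space M)" "t \<le> emeasure M (space M)"
    using distribution_le_space[of M f e] t s by (auto intro: order_trans)
  note [measurable] = initial_sets[OF s_le(1)] initial_sets[OF s_le(2)]
  have eA: "ae_class M (\<lambda>\<omega>. e * indicator A \<omega>) \<in> E \<and> N (ae_class M (\<lambda>\<omega>. e * indicator A \<omega>)) \<le> N (ae_class M f)"
    using e by (intro ideal) (auto simp: E A_def indicator_def)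
  then have "ae_class M (\<lambda>\<omega>. (1 / e) * (e * indicator A \<omega>)) \<in> E"
    by (intro scale_mem[where f = "\<lambda>\<omega>. e * indicator A \<omega>"] conjunct1[OF eA]) measurable
  moreover have "(\<lambda>\<omega>. (1 / e) * (e * indicator A \<omega>)) = (indicator A :: _ \<Rightarrow> real)"
    using e by (simp add: fun_eq_iff)
  ultimately have A_E: "ae_class M (indicator A) \<in> E" by (simp only:)
  have NA: "e * N (ae_class M (indicator A)) \<le> N (ae_class M f)"
    using eA norm_scale[of "indicator A" e] A_E e by simp
  \<comment> \<open>\<open>A\<close> and the preimage of \<open>initial s\<close> both have measure
    \<open>s\<close>, so their indicators are equimeasurable.\<close>
  have "distribution M (\<lambda>\<omega>. indicator (initial s) (U \<omega>)) y = distribution M (indicator A) y" if "0 \<le> y" for y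
    using that s_le by (simp add: distribution_comp distribution_indicator initial_emeasure s_def)
  then have s_E: "pull (indicator (initial s)) \<in> E \<and> N (pull (indicator (initial s))) = N (ae_class M (indicator A))"
    using A_E by (intro symmetric) auto
  have "initial t \<subseteq> initial s" using t s by (auto simp: initial_def)
  then have t_E: "pull (indicator (initial t)) \<in> E \<and> N (pull (indicator (initial t))) \<le> N (pull (indicator (initial s)))"
    using s_E by (intro ideal) (auto simp: indicator_def)
  then show "pull (indicator (initial t)) \<in> E" by simp
  show "e * N (pull (indicator (initial t))) \<le> N (ae_class M f)"
  proof -
    have "e * N (pull (indicator (initial t))) \<le> e * N (ae_class M (indicator A))"
      using s_E t_E e by (intro mult_left_mono) auto
    also note NA
    finally show ?thesis .
  qed
qed

lemma initial_nonzero: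
  assumes "0 < t" "t \<le> emeasure M (space M)"
  shows "ae_class M (\<lambda>\<omega>. indicator (initial t) (U \<omega>) :: real) \<noteq> ae_class M (\<lambda>\<omega>. 0)"
proof
  note [measurable] = initial_sets[OF assms(2)]
  assume "ae_class M (\<lambda>\<omega>. indicator (initial t) (U \<omega>) :: real) = ae_class M (\<lambda>\<omega>. 0)"
  then have "AE \<omega> in M. indicator (initial t) (U \<omega>) = (0::real)"
    by (simp add: ae_class_eq_iff)
  moreover have "{x\<in>space S. indicator (initial t) x = (0::real)} \<in> sets S" by measurable
  ultimately have "AE x in S. indicator (initial t) x = (0::real)"
    by (simp only: AE_comp_iff)
  then have "AE x in S. x \<notin> initial t"
    by eventually_elim (simp add: indicator_def split: if_splits)
  then have "emeasure S (initial t) = 0"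
    using AE_iff_measurable[of "initial t" S "\<lambda>x. x \<notin> initial t"] initial_sets[OF assms(2)]
    by (simp add: initial_def)
  with assms show False by (simp add: initial_emeasure)
qed

text \<open>Chebyshev's inequality with a threshold uniform in \<open>f\<close>: if \<open>f\<close>
  exceeds \<open>e\<close> on measure at least \<open>d\<close>, its norm is at least
  \<open>e\<close> times that of one fixed indicator, which is positive.\<close>

lemma small_norm_imp_small_distribution:
  assumes e: "0 < e" and d: "0 < d"
  shows "\<exists>c>0. \<forall>f\<in>borel_measurable M. ae_class M f \<in> E \<longrightarrow> N (ae_class M f) < c \<longrightarrow>
    distribution M f e \<le> d"
proof (cases "d \<le> emeasure M (space M) \<and> pull (indicator (initial d)) \<in> E")
  case True
  then have "N (pull (indicator (initial d))) \<noteq> 0"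
    using norm_eq_0_iff initial_nonzero[OF d] by blast
  with True norm_nonneg have pos: "N (pull (indicator (initial d))) > 0" by (simp add: order_less_le)
  show ?thesis
  proof (intro exI[of _ "e * N (pull (indicator (initial d)))"] conjI ballI impI)
    show "0 < e * N (pull (indicator (initial d)))" using pos e by simp
    fix f assume f: "f \<in> borel_measurable M" "ae_class M f \<in> E"
      "N (ae_class M f) < e * N (pull (indicator (initial d)))"
    show "distribution M f e \<le> d"
      using Chebyshev_initial(2)[OF f(1,2) e, of d] f(3) by (cases "d \<le> distribution M f e") auto
  qed
next
  case False
  \<comment> \<open>Either \<open>d\<close> exceeds the total measure, or a larger distribution
    value would put the excluded indicator into \<open>E\<close>. The bound thus holds for all
    members of \<open>E\<close> and any threshold serves.\<close>
  have "distribution M f e \<le> d" if "f \<in> borel_measurable M" "ae_class M f \<in> E" for f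
    using Chebyshev_initial(1)[OF that e, of d] distribution_le_space[of M f e] False
    by (meson linear order_trans)
  then show ?thesis by (intro exI[of _ 1]) auto
qed

text \<open>The argument of Riesz: choose indices for which \<open>(1/2) ^ k\<close> is exceeded
  only on measure at most \<open>(1/2) ^ k\<close>. These measures are summable, so Borel-Cantelli
  applies.\<close>

lemma norm_convergent_AE_subsequence:
  assumes [measurable]: "\<And>n. u n \<in> borel_measurable M" and E: "\<And>n. ae_class M (u n) \<in> E"
    and lim: "(\<lambda>n. N (ae_class M (u n))) \<longlonglongrightarrow> 0"
  obtains r where "strict_mono r" "AE \<omega> in M. (\<lambda>k. u (r k) \<omega>) \<longlonglongrightarrow> 0"
proof -
  have "\<exists>n>m. distribution M (u n) ((1/2) ^ k) \<le> ennreal ((1/2) ^ k)" for m k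
  proof -
    obtain c where c: "c > 0" "\<forall>f\<in>borel_measurable M. ae_class M f \<in> E \<longrightarrow> N (ae_class M f) < c \<longrightarrow>
      distribution M f ((1/2) ^ k) \<le> ennreal ((1/2) ^ k)"
      using small_norm_imp_small_distribution[of "(1/2) ^ k" "ennreal ((1/2) ^ k)"] by auto
    have "eventually (\<lambda>n. N (ae_class M (u n)) < c) sequentially"
      using order_tendstoD(2)[OF lim c(1)] .
    then obtain K where K: "\<And>n. n \<ge> K \<Longrightarrow> N (ae_class M (u n)) < c"
      unfolding eventually_sequentially by blast
    \<comment> \<open>Taking the maximum with \<open>Suc m\<close> makes the chosen indices strictly
      increasing.\<close>
    have "distribution M (u (max K (Suc m))) ((1/2) ^ k) \<le> ennreal ((1/2) ^ k)"
      using c(2) E K assms(1) by simp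
    moreover have "max K (Suc m) > m" by simp
    ultimately show ?thesis by blast
  qed
  then have "\<exists>r. \<forall>k. distribution M (u (r k)) ((1/2) ^ k) \<le> ennreal ((1/2) ^ k) \<and> r k < r (Suc k)"
    by (intro dependent_nat_choice[where P = "\<lambda>k n. distribution M (u n) ((1/2) ^ k) \<le> ennreal ((1/2) ^ k)"
          and Q = "\<lambda>k. (<)"]) blast+
  then obtain r where r: "\<And>k. distribution M (u (r k)) ((1/2) ^ k) \<le> ennreal ((1/2) ^ k)"
    "\<And>k. r k < r (Suc k)" by blast
  define A where "A k = {\<omega>\<in>space M. \<bar>u (r k) \<omega>\<bar> > (1/2) ^ k}" for k
  have A [measurable]: "A k \<in> sets M" for k unfolding A_def by measurable
  have A_le: "emeasure M (A k) \<le> ennreal ((1/2) ^ k)" for k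
    using r(1)[of k] by (simp add: A_def distribution_def)
  have "AE \<omega> in M. eventually (\<lambda>k. \<omega> \<in> space M - A k) sequentially"
  proof (rule borel_cantelli_AE1)
    show "emeasure M (A k) < \<infinity>" for k
      using A_le[of k] ennreal_less_top order_le_less_trans by (simp only: infinity_ennreal_def) blast
    have "measure M (A k) \<le> (1/2) ^ k" for k
      unfolding measure_def by (rule enn2real_leI) (simp_all add: A_le)
    then show "summable (\<lambda>k. measure M (A k))"
      by (intro summable_comparison_test'[OF summable_geometric[of "1/2"]]) simp_all
  qed simp
  then have "AE \<omega> in M. (\<lambda>k. u (r k) \<omega>) \<longlonglongrightarrow> 0"
  proof eventually_elim
    case (elim \<omega>)
    show ?case
    proof (rule Lim_null_comparison)
      show "eventually (\<lambda>k. norm (u (r k) \<omega>) \<le> (1/2) ^ k) sequentially"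
        using elim by eventually_elim (auto simp: A_def)
      show "(\<lambda>k. (1/2::real) ^ k) \<longlonglongrightarrow> 0"
        by (intro LIMSEQ_realpow_zero) auto
    qed
  qed
  moreover have "strict_mono r" using r(2) by (simp add: strict_mono_Suc_iff)
  ultimately show thesis using that by blast
qed

section \<open>The axioms of a symmetric space on the interval\<close>

lemma symmetric_space_standard:
  "symmetric_space S (standard_E M E) (standard_norm M E N)"
proof -
  interpret S: nonatomic_measure_space S by (rule nonatomic_standard_space)
  \<comment> \<open>As rewrite rules these turn membership and norm on the interval into membership
    and norm of the pullback in \<open>E\<close>.\<close>
  note [simp] = mem_standard_E_iff standard_norm_pull
  show ?thesis
  proof
    show "standard_E M E \<subseteq> L0 S"
      by (auto simp: standard_E_def L0_def)
    show "ae_class S (\<lambda>x. 0) \<in> standard_E M E"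
      using zero_mem by simp
    show "ae_class S (\<lambda>x. f x + g x) \<in> standard_E M E"
      if [measurable]: "f \<in> borel_measurable S" "g \<in> borel_measurable S"
        and "ae_class S f \<in> standard_E M E" "ae_class S g \<in> standard_E M E" for f g
      using that add_mem[of "\<lambda>\<omega>. f (U \<omega>)" "\<lambda>\<omega>. g (U \<omega>)"] by simp
    show "ae_class S (\<lambda>x. c * f x) \<in> standard_E M E"
      if [measurable]: "f \<in> borel_measurable S" and "ae_class S f \<in> standard_E M E" for f c
      using that scale_mem[of "\<lambda>\<omega>. f (U \<omega>)"] by simp
    show "standard_norm M E N (ae_class S (\<lambda>x. c * f x)) = \<bar>c\<bar> * standard_norm M E N (ae_class S f)"
      if [measurable]: "f \<in> borel_measurable S" and "ae_class S f \<in> standard_E M E" for f c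
      using that scale_mem[of "\<lambda>\<omega>. f (U \<omega>)" c] norm_scale[of "\<lambda>\<omega>. f (U \<omega>)" c] by simp
    show "standard_E M E \<noteq> {ae_class S (\<lambda>x. 0)}"
    proof -
      obtain F where F: "F \<in> E" "F \<noteq> ae_class M (\<lambda>x. 0)"
        using nonzero zero_mem by blast
      then obtain f where f [measurable]: "f \<in> borel_measurable M" and "F = ae_class M f"
        using mem_E_obtain by blast
      then have "\<not> (AE \<omega> in M. f \<omega> = 0)" using F by (simp add: ae_class_eq_iff)
      \<comment> \<open>A nonzero \<open>f\<close> need not be a pullback, but it exceeds some
        \<open>1/(n+1)\<close> on a set of positive measure; \<open>Chebyshev_initial\<close> then
        yields a nonzero indicator that lives on the interval.\<close>
      have "\<exists>n. distribution M f (inverse (real (Suc n))) \<noteq> 0"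
      proof (rule ccontr)
        assume "\<nexists>n. distribution M f (inverse (real (Suc n))) \<noteq> 0"
        then have "AE \<omega> in M. \<not> \<bar>f \<omega>\<bar> > inverse (real (Suc n))" for n
          using AE_iff_measurable[of "{\<omega>\<in>space M. \<bar>f \<omega>\<bar> > inverse (real (Suc n))}" M "\<lambda>\<omega>. \<not> \<bar>f \<omega>\<bar> > inverse (real (Suc n))"]
          by (auto simp: distribution_def)
        then have "AE \<omega> in M. \<forall>n. \<not> \<bar>f \<omega>\<bar> > inverse (real (Suc n))"
          by (simp add: AE_all_countable)
        then have "AE \<omega> in M. f \<omega> = 0"
          by eventually_elim (metis reals_Archimedean zero_less_abs_iff)
        with \<open>\<not> (AE \<omega> in M. f \<omega> = 0)\<close> show False by simp
      qed
      then obtain n where n: "0 < distribution M f (inverse (real (Suc n)))"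
        by (auto simp: zero_less_iff_neq_zero)
      define t where "t = distribution M f (inverse (real (Suc n)))"
      have t: "0 < t" "t \<le> emeasure M (space M)"
        using n distribution_le_space by (auto simp: t_def)
      have [measurable]: "initial t \<in> sets S" using t by simp
      have "pull (indicator (initial t)) \<in> E"
        using F \<open>F = ae_class M f\<close> by (intro Chebyshev_initial(1)[OF f]) (auto simp: t_def)
      then have "ae_class S (indicator (initial t)) \<in> standard_E M E" by simp
      moreover have "ae_class S (indicator (initial t) :: real \<Rightarrow> real) \<noteq> ae_class S (\<lambda>x. 0)"
      proof
        assume "ae_class S (indicator (initial t) :: real \<Rightarrow> real) = ae_class S (\<lambda>x. 0)"
        then have "AE x in S. indicator (initial t) x = (0::real)"
          by (simp add: ae_class_eq_iff)
        moreover have "{x\<in>space S. indicator (initial t) x = (0::real)} \<in> sets S" by measurable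
        ultimately have "AE \<omega> in M. indicator (initial t) (U \<omega>) = (0::real)"
          by (simp only: AE_comp_iff)
        then show False
          using initial_nonzero[OF t] by (simp add: ae_class_eq_iff)
      qed
      ultimately show ?thesis by blast
    qed
    show "0 \<le> standard_norm M E N F" if "F \<in> standard_E M E" for F
      using that norm_nonneg by (elim mem_standard_E_obtain) simp
    show "standard_norm M E N F = 0 \<longleftrightarrow> F = ae_class S (\<lambda>x. 0)" if F: "F \<in> standard_E M E" for F
    proof -
      obtain g where g [measurable]: "g \<in> borel_measurable S" and F: "F = ae_class S g" "pull g \<in> E"
        using mem_standard_E_obtain[OF F] by blast
      have "standard_norm M E N F = 0 \<longleftrightarrow> (AE \<omega> in M. g (U \<omega>) = 0)"
        using F norm_eq_0_iff by (simp add: ae_class_eq_iff)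
      also have "\<dots> \<longleftrightarrow> (AE x in S. g x = 0)"
        by (rule AE_comp_iff[symmetric]) measurable
      also have "\<dots> \<longleftrightarrow> F = ae_class S (\<lambda>x. 0)"
        unfolding F(1) by (simp add: ae_class_eq_iff)
      finally show ?thesis .
    qed
    obtain C where C: "C \<ge> 1" "\<forall>f\<in>borel_measurable M. \<forall>g\<in>borel_measurable M.
          ae_class M f \<in> E \<longrightarrow> ae_class M g \<in> E \<longrightarrow>
          N (ae_class M (\<lambda>x. f x + g x)) \<le> C * (N (ae_class M f) + N (ae_class M g))"
      using quasi_triangle by blast
    show "\<exists>C\<ge>1. \<forall>f\<in>borel_measurable S. \<forall>g\<in>borel_measurable S.
          ae_class S f \<in> standard_E M E \<longrightarrow> ae_class S g \<in> standard_E M E \<longrightarrow>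
          standard_norm M E N (ae_class S (\<lambda>x. f x + g x)) \<le>
            C * (standard_norm M E N (ae_class S f) + standard_norm M E N (ae_class S g))"
    proof (intro exI[of _ C] conjI ballI impI)
      fix f g assume [measurable]: "f \<in> borel_measurable S" "g \<in> borel_measurable S"
        and "ae_class S f \<in> standard_E M E" "ae_class S g \<in> standard_E M E"
      then show "standard_norm M E N (ae_class S (\<lambda>x. f x + g x)) \<le>
            C * (standard_norm M E N (ae_class S f) + standard_norm M E N (ae_class S g))"
        using add_mem[of "\<lambda>\<omega>. f (U \<omega>)" "\<lambda>\<omega>. g (U \<omega>)"] C(2) by simp
    qed (rule C(1))
    show "ae_class S f \<in> standard_E M E \<and> standard_norm M E N (ae_class S f) \<le> standard_norm M E N (ae_class S g)"
      if [measurable]: "f \<in> borel_measurable S" "g \<in> borel_measurable S"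
        and g: "ae_class S g \<in> standard_E M E" and le: "AE x in S. \<bar>f x\<bar> \<le> \<bar>g x\<bar>" for f g
    proof -
      have "{x\<in>space S. \<bar>f x\<bar> \<le> \<bar>g x\<bar>} \<in> sets S" by measurable
      then have "AE \<omega> in M. \<bar>f (U \<omega>)\<bar> \<le> \<bar>g (U \<omega>)\<bar>"
        using le by (simp only: AE_comp_iff)
      then show ?thesis
        using ideal[of "\<lambda>\<omega>. f (U \<omega>)" "\<lambda>\<omega>. g (U \<omega>)"] g by simp
    qed
    show "ae_class S f \<in> standard_E M E \<and> standard_norm M E N (ae_class S f) = standard_norm M E N (ae_class S g)"
      if [measurable]: "f \<in> borel_measurable S" "g \<in> borel_measurable S"
        and g: "ae_class S g \<in> standard_E M E" and eq: "\<forall>x\<ge>0. distribution S f x = distribution S g x" for f g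
      using symmetric[of "\<lambda>\<omega>. f (U \<omega>)" "\<lambda>\<omega>. g (U \<omega>)"] g eq by (simp add: distribution_comp)
    show "\<exists>f\<in>borel_measurable S. ae_class S f \<in> standard_E M E \<and>
        (\<lambda>n. standard_norm M E N (ae_class S (\<lambda>x. u n x - f x))) \<longlonglongrightarrow> 0"
      if u [measurable]: "\<And>n. u n \<in> borel_measurable S" and uE: "\<And>n. ae_class S (u n) \<in> standard_E M E"
        and Cauchy: "\<And>e. e > 0 \<Longrightarrow> \<exists>K. \<forall>m\<ge>K. \<forall>n\<ge>K. standard_norm M E N (ae_class S (\<lambda>x. u m x - u n x)) < e"
      for u :: "nat \<Rightarrow> real \<Rightarrow> real"
    proof -
      \<comment> \<open>\<open>standard_norm_pull\<close> applies only to members, so differences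
        must be known to lie in \<open>E\<close> before their norms can be translated.\<close>
      have diff_mem: "ae_class M (\<lambda>x. f x - g x) \<in> E"
        if [measurable]: "f \<in> borel_measurable M" "g \<in> borel_measurable M"
          and "ae_class M f \<in> E" "ae_class M g \<in> E" for f g
        using that add_mem[of f "\<lambda>x. -1 * g x"] scale_mem[of g "-1"] by simp
      have uE': "pull (u n) \<in> E" for n using uE[of n] by simp
      have "\<exists>K. \<forall>m\<ge>K. \<forall>n\<ge>K. N (ae_class M (\<lambda>\<omega>. u m (U \<omega>) - u n (U \<omega>))) < e" if "e > 0" for e
        using Cauchy[OF that] diff_mem[OF _ _ uE' uE'] by simp
      with complete_norm[of "\<lambda>n \<omega>. u n (U \<omega>)"] uE' obtain f where
        f [measurable]: "f \<in> borel_measurable M" and fE: "ae_class M f \<in> E"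
        and lim: "(\<lambda>n. N (ae_class M (\<lambda>\<omega>. u n (U \<omega>) - f \<omega>))) \<longlonglongrightarrow> 0" by auto
      obtain r where r: "strict_mono r" "AE \<omega> in M. (\<lambda>k. u (r k) (U \<omega>) - f \<omega>) \<longlonglongrightarrow> 0"
        using norm_convergent_AE_subsequence[of "\<lambda>n \<omega>. u n (U \<omega>) - f \<omega>"] lim diff_mem[OF _ _ uE' fE] by auto
      \<comment> \<open>The limit \<open>f\<close> in \<open>E\<close> is not known to be a
        pullback; \<open>h\<close> is built on the interval instead. Where the subsequence diverges
        \<open>lim\<close> has an unspecified value, harmless because convergence holds at
        \<open>U \<omega>\<close> for almost every \<open>\<omega>\<close>, and there
        \<open>h (U \<omega>)\<close> is \<open>f \<omega>\<close>.\<close>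
      define h where "h x = lim (\<lambda>k. u (r k) x)" for x
      have h [measurable]: "h \<in> borel_measurable S" unfolding h_def by measurable
      have "AE \<omega> in M. h (U \<omega>) = f \<omega>"
        using r(2)
      proof eventually_elim
        case (elim \<omega>)
        then have "(\<lambda>k. u (r k) (U \<omega>)) \<longlonglongrightarrow> f \<omega>" by (simp add: LIM_zero_iff)
        then show ?case by (simp add: h_def limI)
      qed
      then have hf: "pull h = ae_class M f" "ae_class M (\<lambda>\<omega>. u n (U \<omega>) - h (U \<omega>)) = ae_class M (\<lambda>\<omega>. u n (U \<omega>) - f \<omega>)" for n
        by (auto simp: ae_class_eq_iff)
      have "ae_class M (\<lambda>\<omega>. u n (U \<omega>) - h (U \<omega>)) \<in> E" for n
        unfolding hf(2) by (intro diff_mem uE' fE) auto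
      then show ?thesis
        using fE lim hf by (intro bexI[of _ h]) auto
    qed
  qed
qed

section \<open>Strict equimeasurability\<close>

lemma
  shows equimeasurable_standard: "Xi M E = Xi S (standard_E M E)"
    and Xi_norm_standard: "H \<in> Xi M E \<Longrightarrow> Xi_norm M E N H = Xi_norm S (standard_E M E) (standard_norm M E N) H"
proof -
  interpret S: symmetric_space S "standard_E M E" "standard_norm M E N"
    by (rule symmetric_space_standard)
  have forth: "\<exists>g\<in>borel_measurable S. ae_class S g \<in> standard_E M E \<and> same_rearrangement M g f \<and>
      rearrangement S g = rearrangement M f \<and> rearrangement_class S g = rearrangement_class M f"
    if [measurable]: "f \<in> borel_measurable M" and E: "ae_class M f \<in> E"
      and fin: "AE x in S. rearrangement M f x < \<infinity>" for f
  proof -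
    \<comment> \<open>The rearrangement of \<open>f\<close> is itself the function on the interval
      equimeasurable with \<open>f\<close>.\<close>
    define g where "g x = enn2real (rearrangement M f x)" for x
    have g [measurable]: "g \<in> borel_measurable S" unfolding g_def by measurable
    have dist: "distribution S g y = distribution M f y" if "0 \<le> y" for y
      unfolding g_def using that fin by (intro distribution_enn2real_rearrangement) auto
    then have "same_rearrangement M g f" by (simp add: same_rearrangement_iff)
    moreover from this have "ae_class S g \<in> standard_E M E"
      unfolding standard_E_def using E g that(1) by blast
    moreover have "rearrangement S g = rearrangement M f" by (rule rearrangement_cong) (rule dist)
    ultimately show ?thesis
      by (intro bexI[of _ g]) (simp_all add: rearrangement_class_def)
  qed
  show eq: "Xi M E = Xi S (standard_E M E)"
  proof (intro set_eqI iffI)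
    fix H assume "H \<in> Xi M E"
    then obtain f where f: "f \<in> borel_measurable M" "ae_class M f \<in> E"
      "AE x in S. rearrangement M f x < \<infinity>" "H = rearrangement_class M f"
      unfolding Xi_def by blast
    obtain g where g: "g \<in> borel_measurable S" "ae_class S g \<in> standard_E M E"
      "rearrangement S g = rearrangement M f" "rearrangement_class S g = rearrangement_class M f"
      using forth[OF f(1-3)] by blast
    have "AE x in standard_space S. rearrangement S g x < \<infinity>" "H = rearrangement_class S g"
      unfolding standard_space_idem g(3,4) by (rule f)+
    with g(1,2) show "H \<in> Xi S (standard_E M E)"
      unfolding Xi_def by blast
  next
    fix H assume "H \<in> Xi S (standard_E M E)"
    then obtain g where g [measurable]: "g \<in> borel_measurable S" and gE: "ae_class S g \<in> standard_E M E"
      and fin: "AE x in S. rearrangement S g x < \<infinity>" and H: "H = rearrangement_class S g"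
      unfolding Xi_def standard_space_idem by blast
    \<comment> \<open>For the opposite inclusion the pullback of \<open>g\<close> serves as the
      function on \<open>M\<close>.\<close>
    have "rearrangement M (\<lambda>\<omega>. g (U \<omega>)) = rearrangement S g"
      by (rule rearrangement_cong) (simp add: distribution_comp)
    moreover from this have "rearrangement_class M (\<lambda>\<omega>. g (U \<omega>)) = H"
      by (simp add: H rearrangement_class_def)
    moreover have "pull g \<in> E" using gE by (simp add: mem_standard_E_iff)
    ultimately show "H \<in> Xi M E"
      unfolding Xi_def using fin by (intro CollectI exI[of _ "\<lambda>\<omega>. g (U \<omega>)"]) simp
  qed
  assume "H \<in> Xi M E"
  then obtain f where f: "f \<in> borel_measurable M" "ae_class M f \<in> E"
    "AE x in S. rearrangement M f x < \<infinity>" "H = rearrangement_class M f"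
    unfolding Xi_def by blast
  obtain g where g: "g \<in> borel_measurable S" "ae_class S g \<in> standard_E M E" "same_rearrangement M g f"
    "rearrangement S g = rearrangement M f" "rearrangement_class S g = rearrangement_class M f"
    using forth[OF f(1-3)] by blast
  \<comment> \<open>Both sides reduce to \<open>N (ae_class M f)\<close>: directly on
    \<open>M\<close>, and on the interval through \<open>g\<close>, whose norm
    \<open>standard_norm_eq\<close> computes from \<open>f\<close>.\<close>
  show "Xi_norm M E N H = Xi_norm S (standard_E M E) (standard_norm M E N) H"
    using Xi_norm_eq[OF f(1-3)] S.Xi_norm_eq[OF g(1,2), unfolded standard_space_idem g(4,5), OF f(3)] standard_norm_eq[OF g(1) f(1,2) g(3)] f g by simp
qed

end

text \<open>A definite description says something only if its value is unique; hence the first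
  conjunct, which makes the norm on the interval independent of the chosen witness.\<close>

theorem theorem2:
  fixes M :: "'a measure"
    and E :: "('a \<Rightarrow> real) set set"
    and N :: "('a \<Rightarrow> real) set \<Rightarrow> real"
  assumes "symmetric_space M E N"
  shows "(\<forall>g\<in>borel_measurable (standard_space M). \<forall>f\<in>borel_measurable M.
            ae_class M f \<in> E \<longrightarrow> same_rearrangement M g f \<longrightarrow>
            standard_norm M E N (ae_class (standard_space M) g) = N (ae_class M f)) \<and>
         standard_symmetric_space (standard_space M) (standard_E M E) (standard_norm M E N) \<and>
         strictly_equimeasurable M E N (standard_space M) (standard_E M E) (standard_norm M E N)"
proof -
  interpret symmetric_space M E N by fact
  obtain U where "U \<in> measurable M (standard_space M)"
    "distr M (standard_space M) U = standard_space M"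
    using measure_preserving_map .
  then interpret symmetric_space_transport M E N U by unfold_locales
  \<comment> \<open>Positive total measure gives the interval positive length in the finite
    case.\<close>
  have "standard_space M = lebesgue_on {0..} \<or> (\<exists>a>0. standard_space M = lebesgue_on {0..a})"
  proof (cases "emeasure M (space M) = \<infinity>")
    case False
    then have "measure M (space M) > 0"
      using space_pos by (simp add: emeasure_eq_ennreal_measure)
    with False show ?thesis
      by (auto simp: standard_space_def standard_interval_def)
  qed (simp add: standard_space_def standard_interval_def)
  then show ?thesis
    unfolding standard_symmetric_space_def strictly_equimeasurable_def equimeasurable_def
    using standard_norm_eq symmetric_space_standard equimeasurable_standard Xi_norm_standard by blast
qed

end
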